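(* Let $N\ge0$ be an integer and $p$ a complex number with $|p|<1$. For generic complex parameters $a,b,c,d,q$, there are unique coefficients $R_k^l=R_k^l(a,b,c,d;N;q,p)$, $0\le k,l\le N$, such that, as functions of $\xi\in\mathbb C\setminus\{0\}$ with $x=\xi+\xi^{-1}$, $$h_k(x;a)h_{N-k}(x;b)=\sum_{l=0}^N R_k^l(a,b,c,d;N;q,p)\,h_l(x;c)h_{N-l}(x;d),$$ and they are given by $$R_k^l=q^{l(l-N)}\frac{(q;q,p)_N}{(q;q,p)_l(q;q,p)_{N-l}}\cdot\frac{(ac,a/c;q,p)_k\,(q^{N-l}bd,b/d;q,p)_l\,(b/c;q,p)_{N-k}\,(b/c;q,p)_{N-l}\,(bc;q,p)_{N-k}}{(q^{l-N}c/d;q,p)_l\,(q^{-l}d/c;q,p)_{N-l}\,(cd;q,p)_N\,(b/c;q,p)_N\,(bc;q,p)_l}$$ $$\times{}_{12}V_{11}\big(q^{-N}c/b;\,q^{-k},q^{-l},q^{k-N}a/b,q^{l-N}c/d,cd,q^{1-N}/(ab),qc/b;\,q,p\big).$$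
   Context: $\theta(x;p)=\prod_{j=0}^\infty(1-p^jx)(1-p^{j+1}/x)$ for $|p|<1$; $(a;q,p)_k=\prod_{j=0}^{k-1}\theta(aq^j;p)$, $(a_1,\dots,a_n;q,p)_k=\prod_i(a_i;q,p)_k$. The elliptic Askey–Wilson monomial is $h_k(x;a)=h_k(x;a;q,p)=(a\xi;q,p)_k(a\xi^{-1};q,p)_k$ where $\xi+\xi^{-1}=x$ (for $a\neq0$). The elliptic very-well-poised series, for $a^3q^{n+2}=bcdefg$, is ${}_{12}V_{11}(a;b,c,d,e,f,g,q^{-n};q,p)=\sum_{k=0}^n\frac{\theta(aq^{2k};p)}{\theta(a;p)}\frac{(a,b,c,d,e,f,g,q^{-n};q,p)_k}{(q,aq/b,aq/c,aq/d,aq/e,aq/f,aq/g,aq^{n+1};q,p)_k}q^k$. At $p=0$ everything reduces to the trigonometric case ($\theta(x;0)=1-x$). *)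

theory Defs
  imports "HOL-Analysis.Analysis"
begin

definition etheta :: "complex \<Rightarrow> complex \<Rightarrow> complex" where
  "etheta x p = prodinf (\<lambda>j. (1 - p ^ j * x) * (1 - p ^ (j + 1) / x))"

definition epoch :: "complex \<Rightarrow> complex \<Rightarrow> complex \<Rightarrow> nat \<Rightarrow> complex" where
  "epoch a q p k = (\<Prod>j<k. etheta (a * q ^ j) p)"

text \<open>Elliptic Askey-Wilson monomial h_k(x;a;q,p) = (a xi, a/xi; q,p)_k,
  written as a function of xi (where x = xi + 1/xi).\<close>
definition eh :: "complex \<Rightarrow> complex \<Rightarrow> complex \<Rightarrow> nat \<Rightarrow> complex \<Rightarrow> complex" where
  "eh q p a k \<xi> = epoch (a * \<xi>) q p k * epoch (a / \<xi>) q p k"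

text \<open>Terminating elliptic very-well-poised series
  12V11(a; b,c,d,e,f,g, q^-n; q,p) (the balancing condition is imposed where it is used).\<close>
definition V12 :: "complex \<Rightarrow> complex \<Rightarrow> complex \<Rightarrow> complex \<Rightarrow> complex \<Rightarrow> complex
    \<Rightarrow> complex \<Rightarrow> complex \<Rightarrow> complex \<Rightarrow> nat \<Rightarrow> complex" where
  "V12 q p a b c d e f g n =
     (\<Sum>k\<le>n. etheta (a * q ^ (2 * k)) p / etheta a p
        * (epoch a q p k * epoch b q p k * epoch c q p k * epoch d q p k
           * epoch e q p k * epoch f q p k * epoch g q p k * epoch (q powi (- int n)) q p k)
        / (epoch q q p k * epoch (a * q / b) q p k * epoch (a * q / c) q p k
           * epoch (a * q / d) q p k * epoch (a * q / e) q p k * epoch (a * q / f) q p k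
           * epoch (a * q / g) q p k * epoch (a * q ^ (n + 1)) q p k)
        * q ^ k)"

definition Rcoef :: "complex \<Rightarrow> complex \<Rightarrow> complex \<Rightarrow> complex \<Rightarrow> nat \<Rightarrow> complex \<Rightarrow> complex
    \<Rightarrow> nat \<Rightarrow> nat \<Rightarrow> complex" where
  "Rcoef a b c d N q p k l =
     q powi (int l * (int l - int N))
     * epoch q q p N / (epoch q q p l * epoch q q p (N - l))
     * (epoch (a * c) q p k * epoch (a / c) q p k
        * epoch (q ^ (N - l) * b * d) q p l * epoch (b / d) q p l
        * epoch (b / c) q p (N - k) * epoch (b / c) q p (N - l) * epoch (b * c) q p (N - k))
     / (epoch (q powi (int l - int N) * c / d) q p l * epoch (q powi (- int l) * d / c) q p (N - l)
        * epoch (c * d) q p N * epoch (b / c) q p N * epoch (b * c) q p l)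
     * V12 q p (q powi (- int N) * c / b)
         (q powi (- int k))
         (q powi (int k - int N) * a / b)
         (q powi (int l - int N) * c / d)
         (c * d)
         (q powi (1 - int N) / (a * b))
         (q * c / b)
         l"

end

theory Submission
  imports Defs
begin

text \<open>
  Everything rests on the three-term addition formula for \<open>\<theta>\<close>. The Jacobi triple product turns
  \<open>\<theta>(xy) \<theta>(x/y)\<close> into a double series which, split by the parity of the sum of its two indices, becomes
  \<open>x (f(x) g(y) - g(x) f(y))\<close>; the addition formula is then a Pluecker relation.

  It yields an elliptic binomial theorem, the expansion of \<open>h\<^sub>n(x;a)\<close> in the products
  \<open>h\<^sub>k(x;b) h\<^sub>n\<^sub>-\<^sub>k(x;c)\<close>, by induction on \<open>n\<close>: the addition formula splits the new factor, and a second
  instance of it is the Pascal recurrence of the coefficients. Since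
  \<open>h\<^sub>N\<^sub>-\<^sub>k(x;b) h\<^sub>k\<^sub>-\<^sub>j(x;b q\<^sup>N\<^sup>-\<^sup>k) = h\<^sub>N\<^sub>-\<^sub>j(x;b)\<close>, expanding \<open>h\<^sub>k(x;a)\<close> in terms of \<open>c\<close> and
  \<open>b q\<^sup>N\<^sup>-\<^sup>k\<close>, and then \<open>h\<^sub>N\<^sub>-\<^sub>j(x;b)\<close> in terms of \<open>c q\<^sup>j\<close> and \<open>d\<close>, gives \<open>R\<^sub>k\<^sup>l\<close> as a sum over \<open>j\<close>
  which agrees term by term with the very-well-poised series. Uniqueness follows by evaluating at
  \<open>\<xi> = q\<^sup>-\<^sup>m/c\<close>, where the system is triangular.
\<close>

section \<open>The triple product\<close>

text \<open>The main obstacle is bookkeeping. For fixed N the values theta(x q^i) are known to be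
  nonzero only in a finite window of i, while the coefficients mix symbols with shifted and inverted
  arguments. They are therefore rewritten through \<open>gam\<close>, which never vanishes and whose
  shift rule has no side condition. The inversion theta(1/x) = -theta(x)/x brings the symbols to a
  few fixed bases, and the monomials it produces form a separate identity of exponents. "Generic"
  means an open dense set of (a,b,c,d,q), depending on p and N, cut out by finitely many
  nonvanishing conditions: their finiteness gives openness, the countability of the zeros of theta
  gives density. The window exceeds 2N because arguments are shifted by at most q^N and then
  followed for at most N further steps. The triple product is needed only up to a factor independent
  of x, the addition formula being homogeneous in theta. The case p = 0 is separate since the
  derivation of the series divides by powers of p.\<close>

fun gauss_binomial :: "'a::comm_ring_1 \<Rightarrow> nat \<Rightarrow> nat \<Rightarrow> 'a" where
  "gauss_binomial p m 0 = 1"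
| "gauss_binomial p 0 (Suc i) = 0"
| "gauss_binomial p (Suc m) (Suc i) =
     gauss_binomial p m i + p ^ Suc i * gauss_binomial p m (Suc i)"

lemma gauss_binomial_eq_0: "m < i \<Longrightarrow> gauss_binomial p m i = 0"
  by (induction p m i rule: gauss_binomial.induct) auto

text \<open>The product form of the Gaussian binomial, stated without division so that it holds in
  any commutative ring, even where some 1 - p^j vanishes.\<close>

lemma gauss_binomial_mult:
  "i \<le> m \<Longrightarrow> gauss_binomial p m i * ((\<Prod>j<i. 1 - p ^ Suc j) * (\<Prod>j<m - i. 1 - p ^ Suc j))
     = (\<Prod>j<m. 1 - p ^ Suc j)"
proof (induction p m i rule: gauss_binomial.induct)
  case (3 p m i)
  define P where "P = (\<lambda>n. \<Prod>j<n. 1 - p ^ Suc j)"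
  have PS: "P (Suc n) = P n * (1 - p ^ Suc n)" for n by (simp add: P_def)
  have 1: "gauss_binomial p m i * (P i * P (m - i)) = P m"
    using 3 by (simp add: P_def)
  show ?case
  proof (cases "i = m")
    case True
    then show ?thesis using 1
      by (simp add: gauss_binomial_eq_0 P_def algebra_simps)
  next
    case False
    then have "i < m" using 3 by simp
    then obtain r where m: "m = Suc (i + r)" using less_imp_Suc_add by blast
    have 2: "gauss_binomial p m (Suc i) * (P (Suc i) * P r) = P m"
      using 3 \<open>i < m\<close> by (simp add: P_def m del: prod.lessThan_Suc)
    have "gauss_binomial p (Suc m) (Suc i) * (P (Suc i) * P (Suc r))
        = (gauss_binomial p m i * (P i * P (Suc r))) * (1 - p ^ Suc i)
          + (gauss_binomial p m (Suc i) * (P (Suc i) * P r)) * (p ^ Suc i * (1 - p ^ Suc r))"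
      by (simp add: PS algebra_simps)
    also have "\<dots> = P m * (1 - p ^ Suc i) + P m * (p ^ Suc i * (1 - p ^ Suc r))"
      using 1 2 by (simp add: m)
    also have "\<dots> = P (Suc m)"
      by (simp add: PS m algebra_simps power_add)
    finally show ?thesis by (simp add: P_def m del: gauss_binomial.simps prod.lessThan_Suc)
  qed
qed auto

text \<open>Rothe's finite q-binomial theorem. The induction splits off the factor with j = 0 and
  absorbs the shift of j into \<open>p * z\<close>, hence \<open>z\<close> stays arbitrary.\<close>

lemma gauss_binomial_theorem:
  "(\<Prod>j<m. 1 + p ^ j * z) = (\<Sum>i\<le>m. p ^ (i choose 2) * gauss_binomial p m i * z ^ i)"
proof (induction m arbitrary: z)
  case (Suc m)
  have s: "Suc i choose 2 = i + (i choose 2)" for i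
    by (simp add: numeral_2_eq_2)
  let ?t = "\<lambda>m i. p ^ (i choose 2) * gauss_binomial p m i"
  have "(\<Prod>j<Suc m. 1 + p ^ j * z) = (1 + z) * (\<Prod>j<m. 1 + p ^ j * (p * z))"
    by (subst prod.lessThan_Suc_shift) (simp add: algebra_simps)
  also have "\<dots> = (\<Sum>i\<le>m. ?t m i * p ^ i * z ^ i) + (\<Sum>i\<le>m. ?t m i * p ^ i * z ^ Suc i)"
    by (simp only: Suc) (simp add: sum_distrib_left ring_distribs power_mult_distrib mult_ac flip: sum.distrib)
  also have "(\<Sum>i\<le>m. ?t m i * p ^ i * z ^ i) = (\<Sum>i\<le>Suc m. ?t m i * p ^ i * z ^ i)"
    by (simp add: gauss_binomial_eq_0)
  also have "\<dots> = 1 + (\<Sum>i\<le>m. ?t m (Suc i) * p ^ Suc i * z ^ Suc i)"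
    by (subst sum.atMost_Suc_shift) (simp add: numeral_2_eq_2)
  also have "\<dots> + (\<Sum>i\<le>m. ?t m i * p ^ i * z ^ Suc i)
      = 1 + (\<Sum>i\<le>m. ?t (Suc m) (Suc i) * z ^ Suc i)"
    by (simp add: sum.distrib[symmetric] add.assoc s power_add algebra_simps)
  also have "\<dots> = (\<Sum>i\<le>Suc m. ?t (Suc m) i * z ^ i)"
    by (subst sum.atMost_Suc_shift) (simp add: numeral_2_eq_2)
  finally show ?case .
qed (simp add: numeral_2_eq_2)

text \<open>The binomial coefficient (k choose 2) for every integer k, as a natural number, so that
  \<open>p ^ tri k\<close> makes sense for p = 0 too.\<close>

definition tri :: "int \<Rightarrow> nat" where "tri k = nat (k * (k - 1) div 2)"

lemma double_tri: "2 * int (tri k) = k * (k - 1)"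
proof -
  have "k * (k - 1) \<ge> 0" by (cases "k \<le> 0") (auto intro: mult_nonpos_nonpos)
  moreover have "even (k * (k - 1))" by auto
  ultimately show ?thesis by (simp add: tri_def)
qed

lemma tri_eqI: "2 * int m = k * (k - 1) \<Longrightarrow> tri k = m"
  using double_tri[of k] by linarith

lemma double_choose_two: "2 * int (i choose 2) = int i * (int i - 1)"
proof (induction i)
  case (Suc i)
  have "Suc i choose 2 = i + (i choose 2)" by (simp add: numeral_2_eq_2)
  then have "2 * int (Suc i choose 2) = 2 * int i + 2 * int (i choose 2)" by simp
  also note Suc
  finally show ?case by (simp add: algebra_simps)
qed (simp add: numeral_2_eq_2)

text \<open>The q-binomial theorem with 2n factors, centred: for z = -x/p^n the upper n factors are
  1 - p^j x, and the lower n, in reverse order, are 1 - p^(j+1)/x times monomials whose product is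
  1/K.\<close>

lemma finite_triple_product:
  fixes p x :: complex
  assumes "p \<noteq> 0" "x \<noteq> 0"
  shows "(\<Prod>j<n. (1 - p ^ j * x) * (1 - p ^ (j + 1) / x))
       = (\<Sum>k = - int n..int n. gauss_binomial p (2 * n) (nat (int n + k)) * (p ^ tri k * (- x) powi k))"
proof -
  define z where "z = - x / p ^ n"
  define K where "K = p ^ (\<Sum>j<n. j + 1) / (- x) ^ n"
  have sp: "(\<Prod>j<2 * n. f j) = (\<Prod>j<n. f j) * (\<Prod>j<n. f (n + j))" for f :: "nat \<Rightarrow> complex"
    by (simp add: mult_2 lessThan_atLeast0
        prod.atLeastLessThan_concat[symmetric, of 0 n "n + n"] prod.shift_bounds_nat_ivl[of f 0 n n, simplified] add.commute)
  have f1: "1 + p ^ (n + j) * z = 1 - p ^ j * x" for j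
    using assms by (simp add: z_def power_add field_simps)
  have f2: "(\<Prod>j<n. 1 + p ^ j * z) = (\<Prod>j<n. 1 - p ^ (j + 1) / x) / K"
  proof -
    have "(\<Prod>j<n. 1 + p ^ j * z) = (\<Prod>j<n. 1 + p ^ (n - Suc j) * z)"
      by (rule prod.nat_diff_reindex[symmetric])
    also have "\<dots> = (\<Prod>j<n. (1 - p ^ (j + 1) / x) * (- x / p ^ (j + 1)))"
    proof (rule prod.cong)
      fix j assume "j \<in> {..<n}"
      then obtain r where n: "n = Suc (j + r)" using less_imp_Suc_add by blast
      show "1 + p ^ (n - Suc j) * z = (1 - p ^ (j + 1) / x) * (- x / p ^ (j + 1))"
        using assms by (simp add: z_def n power_add field_simps)
    qed simp
    also have "\<dots> = (\<Prod>j<n. 1 - p ^ (j + 1) / x) / K"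
      by (simp only: prod.distrib prod_dividef K_def power_sum) simp
    finally show ?thesis .
  qed
  have K0: "K \<noteq> 0" using assms by (simp add: K_def)
  have "(\<Prod>j<n. (1 - p ^ j * x) * (1 - p ^ (j + 1) / x)) = K * (\<Prod>j<2 * n. 1 + p ^ j * z)"
    unfolding sp f1 f2 using K0 by (simp add: prod.distrib)
  also have "\<dots> = (\<Sum>i\<le>2 * n. K * (p ^ (i choose 2) * gauss_binomial p (2 * n) i * z ^ i))"
    by (simp add: gauss_binomial_theorem sum_distrib_left)
  also have "\<dots> = (\<Sum>k = - int n..int n. gauss_binomial p (2 * n) (nat (int n + k)) * (p ^ tri k * (- x) powi k))"
  proof (rule sum.reindex_bij_witness[where j = "\<lambda>i. int i - int n" and i = "\<lambda>k. nat (int n + k)"])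
    fix i assume "i \<in> {..2 * n}"
    have S: "2 * (\<Sum>j<n. j + 1) = n * (n + 1)" by (induction n) (auto simp: algebra_simps)
    have e: "(\<Sum>j<n. j + 1) + (i choose 2) = tri (int i - int n) + n * i"
    proof -
      have "int (2 * (\<Sum>j<n. j + 1)) = int n * (int n + 1)" unfolding S by (simp add: algebra_simps)
      then have "2 * int ((\<Sum>j<n. j + 1) + (i choose 2)) = 2 * int (tri (int i - int n) + n * i)"
        using double_choose_two[of i] double_tri[of "int i - int n"]
        by (simp add: algebra_simps)
      then show ?thesis by (simp only: mult_cancel_left of_nat_eq_iff) simp
    qed
    have "K * (p ^ (i choose 2) * z ^ i) = p ^ ((\<Sum>j<n. j + 1) + (i choose 2)) / p ^ (n * i) * ((- x) ^ i / (- x) ^ n)"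
      by (simp only: K_def z_def power_add power_divide power_mult) (simp add: mult_ac)
    also have "\<dots> = p ^ tri (int i - int n) * (- x) powi (int i - int n)"
      using assms unfolding e by (simp add: power_add power_int_diff)
    finally show "gauss_binomial p (2 * n) (nat (int n + (int i - int n))) *
           (p ^ tri (int i - int n) * (- x) powi (int i - int n)) =
        K * (p ^ (i choose 2) * gauss_binomial p (2 * n) i * z ^ i)"
      by (simp add: mult_ac)
  qed auto
  finally show ?thesis .
qed

section \<open>Passage to the limit: the bilateral theta series\<close>

lemma summable_on_times:
  fixes f :: "'a \<Rightarrow> complex" and g :: "'b \<Rightarrow> complex"
  assumes "f summable_on A" "g summable_on B"
  shows "(\<lambda>(x, y). f x * g y) summable_on A \<times> B"
  using assms unfolding summable_on_iff_abs_summable_on_complex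
  by (simp add: Infinite_Sum.abs_summable_on_Sigma_iff norm_mult infsum_cmult_right'
      summable_on_cmult_right summable_on_cmult_left abs_mult infsum_nonneg)

lemma infsum_times:
  fixes f :: "'a \<Rightarrow> complex" and g :: "'b \<Rightarrow> complex"
  assumes "f summable_on A" "g summable_on B"
  shows "infsum f A * infsum g B = infsum (\<lambda>(x, y). f x * g y) (A \<times> B)"
proof -
  have "infsum (\<lambda>(x, y). f x * g y) (A \<times> B) = infsum (\<lambda>x. infsum (\<lambda>y. f x * g y) B) A"
    by (rule infsum_Sigma'_banach[symmetric]) (rule summable_on_times[OF assms])
  then show ?thesis by (simp add: infsum_cmult_right' infsum_cmult_left')
qed

text \<open>Tannery's theorem, carried from series over the naturals to sums over the integers by
  the bijection \<open>int_decode\<close>. The bound \<open>M\<close> makes all sums absolutely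
  convergent, so the order of summation is harmless.\<close>

lemma infsum_int_dominated_convergence:
  fixes f :: "nat \<Rightarrow> int \<Rightarrow> complex"
  assumes "\<And>k. (\<lambda>n. f n k) \<longlonglongrightarrow> g k" "\<And>n k. norm (f n k) \<le> M k" "M summable_on UNIV"
  shows "(\<lambda>n. infsum (f n) UNIV) \<longlonglongrightarrow> infsum g UNIV"
proof -
  have M: "summable (\<lambda>k. M (int_decode k))"
  proof (rule summable_on_imp_summable)
    show "(\<lambda>k. M (int_decode k)) summable_on UNIV"
      using assms(3) summable_on_reindex_bij_betw[OF bij_int_decode, of M] by simp
  qed
  have inf: "infsum h UNIV = (\<Sum>k. h (int_decode k))" if "\<And>k. norm (h k) \<le> M k" for h :: "int \<Rightarrow> complex"
  proof -
    have "(\<lambda>k. norm (h k)) summable_on UNIV"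
      by (rule Infinite_Sum.abs_summable_on_comparison_test'[OF assms(3)]) (use that in auto)
    then have "(h has_sum infsum h UNIV) UNIV"
      using summable_on_iff_abs_summable_on_complex has_sum_infsum by blast
    then have "((\<lambda>k. h (int_decode k)) has_sum infsum h UNIV) UNIV"
      using has_sum_reindex_bij_betw[OF bij_int_decode, of h] by simp
    then show ?thesis by (auto dest: has_sum_imp_sums sums_unique)
  qed
  have g: "norm (g k) \<le> M k" for k
    by (rule LIMSEQ_le_const2[OF tendsto_norm[OF assms(1)]]) (use assms(2) in auto)
  have "(\<lambda>n. \<Sum>k. f n (int_decode k)) \<longlonglongrightarrow> (\<Sum>k. g (int_decode k))"
    using tannerys_theorem[where a = "\<lambda>k n. f n (int_decode k)" and F = sequentially
        and M = "\<lambda>k. M (int_decode k)" and b = "\<lambda>k. g (int_decode k)", OF assms(1) _ M]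
      assms(2) by (simp add: always_eventually)
  then show ?thesis using inf assms(2) g by simp
qed

lemma summable_choose_two:
  fixes p z :: complex
  assumes "norm p < 1"
  shows "summable (\<lambda>n. norm (p ^ (n choose 2) * z ^ n))"
proof -
  have "(\<lambda>n. norm p ^ n * norm z) \<longlonglongrightarrow> 0 * norm z"
    by (intro tendsto_intros LIMSEQ_power_zero) (use assms in auto)
  then have "eventually (\<lambda>n. norm p ^ n * norm z < 1/2) sequentially"
    by (rule order_tendstoD) simp
  then obtain N where N: "\<And>n. n \<ge> N \<Longrightarrow> norm p ^ n * norm z < 1/2"
    by (auto simp: eventually_sequentially)
  show ?thesis
  proof (rule summable_ratio_test[of "1/2" N])
    fix n assume "n \<ge> N"
    have s: "Suc n choose 2 = n + (n choose 2)" by (simp add: numeral_2_eq_2)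
    have "norm (norm (p ^ (Suc n choose 2) * z ^ Suc n))
        = (norm p ^ n * norm z) * norm (p ^ (n choose 2) * z ^ n)"
      unfolding s by (simp add: norm_mult norm_power power_add)
    also have "\<dots> \<le> 1/2 * norm (p ^ (n choose 2) * z ^ n)"
      using N[OF \<open>n \<ge> N\<close>] by (intro mult_right_mono) auto
    finally show "norm (norm (p ^ (Suc n choose 2) * z ^ Suc n)) \<le> 1/2 * norm (norm (p ^ (n choose 2) * z ^ n))"
      by simp
  qed simp
qed

lemma tri_of_nat: "tri (int n) = n choose 2"
  by (rule tri_eqI) (rule double_choose_two)

lemma tri_minus_of_nat: "tri (- int n) = (n choose 2) + n"
  by (rule tri_eqI) (use double_choose_two[of n] in \<open>simp add: algebra_simps\<close>)

lemma summable_on_theta: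
  fixes p z :: complex
  assumes "norm p < 1" "z \<noteq> 0"
  shows "(\<lambda>k. p ^ tri k * z powi k) summable_on UNIV"
  unfolding summable_on_iff_abs_summable_on_complex
proof -
  let ?f = "\<lambda>k. norm (p ^ tri k * z powi k)"
  have 1: "?f summable_on range int"
  proof (subst summable_on_reindex)
    show "?f \<circ> int summable_on UNIV"
      using summable_choose_two[OF assms(1), of z]
      by (subst summable_on_UNIV_nonneg_real_iff) (auto simp: o_def tri_of_nat)
  qed simp
  \<comment> \<open>Since (-n choose 2) = (n choose 2) + n, the negative half is again a series of
    the first kind, with z replaced by p/z.\<close>
  have "?f summable_on range (\<lambda>n. - int n)"
  proof (subst summable_on_reindex)
    show "?f \<circ> (\<lambda>n. - int n) summable_on UNIV"
      using summable_choose_two[OF assms(1), of "p / z"]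
      by (subst summable_on_UNIV_nonneg_real_iff)
         (auto simp: o_def tri_minus_of_nat power_int_minus power_add power_divide divide_simps)
  qed (simp add: inj_on_def)
  then have 2: "?f summable_on {..<0}"
  proof (rule summable_on_subset_banach, intro subsetI)
    show "k \<in> range (\<lambda>n. - int n)" if "k \<in> {..<0}" for k
      using that by (intro image_eqI[of _ _ "nat (- k)"]) auto
  qed
  have "k \<in> range int \<union> {..<0}" for k
    by (cases "k < 0") (auto intro!: image_eqI[of _ _ "nat k"])
  then have "range int \<union> {..<0} = UNIV" by blast
  moreover have "?f summable_on range int \<union> {..<0}"
    by (rule summable_on_Un_disjoint[OF 1 2]) auto
  ultimately show "?f summable_on UNIV" by simp
qed

text \<open>Jacobi's theta function as a Laurent series; by the triple product it is (p;p)_infinity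
  times theta(-z;p).\<close>

definition theta_series :: "complex \<Rightarrow> complex \<Rightarrow> complex" where
  "theta_series p z = infsum (\<lambda>k. p ^ tri k * z powi k) UNIV"

lemma convergent_prod_one_minus_power:
  fixes p c :: complex
  assumes "norm p < 1"
  shows "convergent_prod (\<lambda>j. 1 - p ^ j * c)"
proof (rule abs_convergent_prod_imp_convergent_prod, rule summable_imp_abs_convergent_prod)
  show "summable (\<lambda>j. norm (1 - p ^ j * c - 1))"
    using assms by (auto simp: norm_mult norm_power intro!: summable_mult2 summable_geometric)
qed

lemma convergent_prod_etheta:
  fixes p x :: complex
  assumes "norm p < 1"
  shows "convergent_prod (\<lambda>j. (1 - p ^ j * x) * (1 - p ^ (j + 1) / x))"
  using convergent_prod_mult[OF convergent_prod_one_minus_power[OF assms, of x]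
      convergent_prod_one_minus_power[OF assms, of "p / x"]]
  by (simp add: mult_ac)

lemma convergent_prod_LIMSEQ_lessThan:
  fixes f :: "nat \<Rightarrow> complex"
  assumes "convergent_prod f"
  shows "(\<lambda>n. \<Prod>j<n. f j) \<longlonglongrightarrow> prodinf f"
  by (subst filterlim_sequentially_Suc[symmetric])
     (use convergent_prod_LIMSEQ[OF assms] in \<open>simp add: lessThan_Suc_atMost\<close>)

text \<open>The limit of \<open>finite_triple_product\<close>: for fixed k the Gaussian binomial
  tends to 1/(p;p)_infinity, which is the constant \<open>K\<close>.\<close>

lemma etheta_eq_theta_series:
  assumes "norm p < 1" "p \<noteq> 0"
  obtains K where "\<And>x. x \<noteq> 0 \<Longrightarrow> etheta x p = K * theta_series p (- x)"
proof -
  define P where "P = (\<lambda>n. \<Prod>j<n. 1 - p ^ Suc j)"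
  define L where "L = prodinf (\<lambda>j. 1 - p ^ Suc j)"
  have c: "convergent_prod (\<lambda>j. 1 - p ^ Suc j)"
    using convergent_prod_one_minus_power[OF assms(1), of p] by (simp add: mult.commute)
  have nz: "1 - p ^ Suc j \<noteq> 0" for j
  proof
    assume "1 - p ^ Suc j = 0"
    then have "norm (p ^ Suc j) = norm (1 :: complex)" by simp
    then have "norm p ^ Suc j = 1" by (simp only: norm_power norm_one)
    moreover have "norm p ^ Suc j < 1" using assms by (intro power_Suc_less_one) auto
    ultimately show False by simp
  qed
  have PL: "P \<longlonglongrightarrow> L" unfolding P_def L_def by (rule convergent_prod_LIMSEQ_lessThan[OF c])
  have P0: "P n \<noteq> 0" for n using nz by (simp add: P_def)
  have L0: "L \<noteq> 0" unfolding L_def by (rule prodinf_nonzero[OF c nz])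
  \<comment> \<open>\<open>P\<close> and its inverse are both bounded, since the limit
    \<open>L\<close> is nonzero. By the product form this bounds all Gaussian binomials at once,
    which gives the dominating series.\<close>
  obtain B where B: "\<And>n. norm (P n) \<le> B" "B > 0"
    using PL convergentI convergent_imp_Bseq BseqE by metis
  have "(\<lambda>n. inverse (P n)) \<longlonglongrightarrow> inverse L" using PL L0 by (rule tendsto_inverse)
  then obtain D where D: "\<And>n. norm (inverse (P n)) \<le> D" "D > 0"
    using convergentI convergent_imp_Bseq BseqE by metis
  have gb: "gauss_binomial p m i = P m * inverse (P i) * inverse (P (m - i))" if "i \<le> m" for m i
    using gauss_binomial_mult[OF that, of p] P0 by (simp add: P_def field_simps)
  have gbB: "norm (gauss_binomial p m i) \<le> B * D * D" for m i
  proof (cases "i \<le> m")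
    case True
    show ?thesis unfolding gb[OF True] norm_mult using B D
      by (intro mult_mono) (auto simp: less_imp_le)
  qed (use B D in \<open>simp add: gauss_binomial_eq_0\<close>)
  have "etheta x p = inverse L * theta_series p (- x)" if x: "x \<noteq> 0" for x
  proof -
    define t where "t = (\<lambda>k. p ^ tri k * (- x) powi k)"
    \<comment> \<open>Extension by zero puts all the finite sums on the common index set of the
      integers.\<close>
    define f where "f = (\<lambda>n k. if k \<in> {- int n..int n} then gauss_binomial p (2 * n) (nat (int n + k)) * t k else 0)"
    have fsum: "infsum (f n) UNIV = (\<Prod>j<n. (1 - p ^ j * x) * (1 - p ^ (j + 1) / x))" for n
    proof -
      have "infsum (f n) UNIV = infsum (f n) {- int n..int n}"
        by (rule infsum_cong_neutral) (auto simp: f_def)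
      also have "\<dots> = (\<Prod>j<n. (1 - p ^ j * x) * (1 - p ^ (j + 1) / x))"
        by (subst finite_triple_product[OF assms(2) x]) (simp add: f_def t_def)
      finally show ?thesis .
    qed
    have "(\<lambda>n. infsum (f n) UNIV) \<longlonglongrightarrow> infsum (\<lambda>k. inverse L * t k) UNIV"
    proof (rule infsum_int_dominated_convergence)
      show "(\<lambda>n. f n k) \<longlonglongrightarrow> inverse L * t k" for k
      proof (rule Lim_transform_eventually)
        have l1: "(\<lambda>n. P (2 * n)) \<longlonglongrightarrow> L"
          by (rule filterlim_compose[OF PL]) (auto intro!: filterlim_subseq strict_monoI)
        have l2: "(\<lambda>n. P (nat (int n + i))) \<longlonglongrightarrow> L" for i
        proof (rule filterlim_compose[OF PL])
          show "filterlim (\<lambda>n. nat (int n + i)) at_top at_top"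
            unfolding filterlim_at_top eventually_sequentially
          proof
            fix Z show "\<exists>N. \<forall>n\<ge>N. Z \<le> nat (int n + i)"
              by (intro exI[of _ "Z + nat (- i)"]) auto
          qed
        qed
        have "(\<lambda>n. P (2 * n) * inverse (P (nat (int n + k))) * inverse (P (nat (int n + (- k)))) * t k)
           \<longlonglongrightarrow> L * inverse L * inverse L * t k"
          by (intro tendsto_intros l1 l2 L0)
        then show "(\<lambda>n. P (2 * n) * inverse (P (nat (int n + k))) * inverse (P (nat (int n + (- k)))) * t k)
           \<longlonglongrightarrow> inverse L * t k" using L0 by simp
        show "eventually (\<lambda>n. P (2 * n) * inverse (P (nat (int n + k))) * inverse (P (nat (int n + (- k)))) * t k = f n k) sequentially"
          using eventually_ge_at_top[of "nat \<bar>k\<bar>"]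
        proof eventually_elim
          case (elim n)
          then have k: "k \<in> {- int n..int n}" by auto
          then have "2 * n - nat (int n + k) = nat (int n + - k)" "nat (int n + k) \<le> 2 * n"
            by (auto simp: nat_diff_distrib)
          then show ?case using k gb by (simp add: f_def)
        qed
      qed
      show "norm (f n k) \<le> B * D * D * norm (t k)" for n k
        using gbB B D by (auto simp: f_def norm_mult intro!: mult_right_mono)
      show "(\<lambda>k. B * D * D * norm (t k)) summable_on UNIV"
        unfolding t_def using summable_on_theta[OF assms(1), of "- x"] x
        by (intro summable_on_cmult_right) (simp add: summable_on_iff_abs_summable_on_complex)
    qed
    moreover have "(\<lambda>n. infsum (f n) UNIV) \<longlonglongrightarrow> etheta x p"
      unfolding fsum etheta_def by (rule convergent_prod_LIMSEQ_lessThan[OF convergent_prod_etheta[OF assms(1)]])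
    ultimately have "etheta x p = infsum (\<lambda>k. inverse L * t k) UNIV"
      using LIMSEQ_unique by blast
    then show ?thesis by (simp add: theta_series_def t_def infsum_cmult_right')
  qed
  then show ?thesis using that by blast
qed

section \<open>The addition formula\<close>

text \<open>The substitution k -> 1 - k fixes \<open>tri k\<close>.\<close>

lemma theta_series_reflect:
  assumes "x \<noteq> 0"
  shows "theta_series p (- (1 / x)) = - theta_series p (- x) / x"
proof -
  have "theta_series p (- (1 / x)) = infsum (\<lambda>k. (- 1 / x) * (p ^ tri k * (- x) powi k)) UNIV"
    unfolding theta_series_def
  proof (rule infsum_reindex_bij_witness[where i = "\<lambda>k. 1 - k" and j = "\<lambda>k. 1 - k"])
    fix k :: int
    have "tri (1 - k) = tri k" using double_tri[of k] by (intro tri_eqI) (simp add: algebra_simps)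
    moreover have "(- 1 / x) * (- x) powi (1 - k) = (- (1 / x)) powi k"
    proof -
      have "(- (1 / x)) powi k = inverse (- x) powi k" by (simp add: field_simps)
      also have "\<dots> = inverse ((- x) powi k)" by (rule power_int_inverse)
      finally show ?thesis using assms by (simp add: power_int_diff field_simps)
    qed
    ultimately show "(- 1 / x) * (p ^ tri (1 - k) * (- x) powi (1 - k)) = p ^ tri k * (- (1 / x)) powi k"
      by (metis mult.left_commute)
  qed auto
  then show ?thesis by (simp only: infsum_cmult_right' theta_series_def) simp
qed

text \<open>Shifting k by one raises \<open>tri k\<close> by k, which is the power of p gained from
  p z.\<close>

lemma theta_series_quasi_periodic:
  assumes "p \<noteq> 0" "z \<noteq> 0"
  shows "theta_series p (p * z) = theta_series p z / z"
proof -
  have "theta_series p (p * z) = infsum (\<lambda>k. inverse z * (p ^ tri k * z powi k)) UNIV"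
    unfolding theta_series_def
  proof (rule infsum_reindex_bij_witness[where i = "\<lambda>k. k - 1" and j = "\<lambda>k. k + 1"])
    fix k :: int
    have "int (tri (k + 1)) = int (tri k) + k"
      using double_tri[of k] double_tri[of "k + 1"] by (simp add: algebra_simps)
    then have "p powi int (tri (k + 1)) = p powi int (tri k) * p powi k"
      using assms by (simp add: power_int_add)
    then have "p ^ tri (k + 1) = p ^ tri k * p powi k" by simp
    then show "inverse z * (p ^ tri (k + 1) * z powi (k + 1)) = p ^ tri k * (p * z) powi k"
      using assms by (simp add: power_int_add power_int_mult_distrib)
  qed auto
  then show ?thesis by (simp add: infsum_cmult_right' theta_series_def divide_inverse mult.commute)
qed

text \<open>The substitutions (m, n) = (r + s, r - s) and (r + s + 1, r - s) separate the variables
  in tri m + tri n, so each parity class factors into two series with p^2 in place of p.\<close>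

lemma theta_series_product:
  fixes p x y :: complex
  assumes "norm p < 1" "p \<noteq> 0" "x \<noteq> 0" "y \<noteq> 0"
  shows "theta_series p (- (x * y)) * theta_series p (- (x / y))
    = theta_series (p\<^sup>2) (x\<^sup>2) * theta_series (p\<^sup>2) (p * y\<^sup>2)
      - x / y * theta_series (p\<^sup>2) (p * x\<^sup>2) * theta_series (p\<^sup>2) (y\<^sup>2)"
proof -
  define t where "t = (\<lambda>(m, n). (p ^ tri m * (- (x * y)) powi m) * (p ^ tri n * (- (x / y)) powi n))"
  define u where "u = (\<lambda>z k. (p\<^sup>2) ^ tri k * z powi k)"
  have p2: "norm (p\<^sup>2) < 1" using assms by (simp add: norm_power power_less_one_iff)
  have us: "u z summable_on UNIV" if "z \<noteq> 0" for z
    unfolding u_def by (rule summable_on_theta[OF p2 that])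
  have ts: "t summable_on UNIV"
    unfolding t_def UNIV_Times_UNIV[symmetric]
    by (intro summable_on_times summable_on_theta) (use assms in auto)
  have pu: "theta_series (p\<^sup>2) z * theta_series (p\<^sup>2) w = infsum (\<lambda>(r, s). u z r * u w s) UNIV"
    if "z \<noteq> 0" "w \<noteq> 0" for z w
    using infsum_times[OF us[OF that(1)] us[OF that(2)]] by (simp add: theta_series_def u_def)
  have tt: "t (m, n) = p powi (int (tri m) + int (tri n)) * (- x) powi (m + n) * y powi (m - n)" for m n
  proof -
    have "(- (x * y)) powi m = (- x) powi m * y powi m"
      by (subst power_int_mult_distrib[symmetric]) simp
    moreover have "(- (x / y)) powi n = (- x) powi n / y powi n"
      by (subst power_int_divide_distrib[symmetric]) simp
    ultimately show ?thesis using assms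
      by (simp add: t_def power_int_add power_int_diff mult_ac)
  qed
  have uu: "u (p powi i * z\<^sup>2) k = p powi (2 * int (tri k) + i * k) * z powi (2 * k)"
    if "z \<noteq> 0" for z i k
    using assms that by (simp add: u_def power_int_add power_int_mult_distrib power_int_mult power_mult)
  let ?E = "{(m, n). even (m + n :: int)}" and ?O = "{(m, n). odd (m + n :: int)}"
  have E: "infsum t ?E = infsum (\<lambda>(r, s). u (x\<^sup>2) r * u (p * y\<^sup>2) s) UNIV"
  proof (rule infsum_reindex_bij_witness[where i = "\<lambda>(r, s). (r + s, r - s)"
        and j = "\<lambda>(m, n). ((m + n) div 2, (m - n) div 2)"], goal_cases)
    case (1 a) then show ?case by (cases a) (simp, presburger)
  next
    case (5 a)
    then obtain m n where a: "a = (m, n)" and "even (m + n)" by auto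
    then obtain r where "m + n = 2 * r" by (blast elim: evenE)
    define s where "s = r - n"
    have m: "m = r + s" and n: "n = r - s" using \<open>m + n = 2 * r\<close> by (auto simp: s_def)
    have e: "int (tri (r + s)) + int (tri (r - s)) = (2 * int (tri r) + 0 * r) + (2 * int (tri s) + 1 * s)"
      using double_tri[of "r + s"] double_tri[of "r - s"] double_tri[of r] double_tri[of s]
      by (simp add: algebra_simps)
    have "(- x) powi (2 * r) = x powi (2 * r)" by (simp add: power_int_mult)
    then have "t (r + s, r - s) = u (p powi 0 * x\<^sup>2) r * u (p powi 1 * y\<^sup>2) s"
      using assms unfolding tt e uu[OF assms(3)] uu[OF assms(4)] by (simp add: power_int_add)
    then show ?case by (simp add: a m n)
  qed auto
  have O: "infsum t ?O = infsum (\<lambda>(r, s). - (x * y) * (u (p * x\<^sup>2) r * u (p\<^sup>2 * y\<^sup>2) s)) UNIV"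
  proof (rule infsum_reindex_bij_witness[where i = "\<lambda>(r, s). (r + s + 1, r - s)"
        and j = "\<lambda>(m, n). ((m + n) div 2, (m - n) div 2)"], goal_cases)
    case (1 a) then show ?case by (cases a) (simp, presburger)
  next
    case (5 a)
    then obtain m n where a: "a = (m, n)" and "odd (m + n)" by auto
    then obtain r where "m + n = 2 * r + 1" by (blast elim: oddE)
    define s where "s = r - n"
    have m: "m = r + s + 1" and n: "n = r - s" using \<open>m + n = 2 * r + 1\<close> by (auto simp: s_def)
    have e: "int (tri (r + s + 1)) + int (tri (r - s)) = (2 * int (tri r) + 1 * r) + (2 * int (tri s) + 2 * s)"
      using double_tri[of "r + s + 1"] double_tri[of "r - s"] double_tri[of r] double_tri[of s]
      by (simp add: algebra_simps)
    have s1: "r + s + 1 + (r - s) = 2 * r + 1" "r + s + 1 - (r - s) = 2 * s + 1" by auto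
    have "(- x) powi (2 * r + 1) = - x * x powi (2 * r)" using assms by (simp add: power_int_add power_int_mult)
    moreover have "y powi (2 * s + 1) = y * y powi (2 * s)" using assms by (simp add: power_int_add)
    ultimately have "t (r + s + 1, r - s) = - (x * y) * (u (p powi 1 * x\<^sup>2) r * u (p powi 2 * y\<^sup>2) s)"
      using assms unfolding tt e s1 uu[OF assms(3)] uu[OF assms(4)] by (simp add: power_int_add)
    then show ?case by (simp add: a m n)
  qed auto
  have "theta_series p (- (x * y)) * theta_series p (- (x / y)) = infsum t UNIV"
    unfolding theta_series_def t_def UNIV_Times_UNIV[symmetric]
    by (rule infsum_times) (intro summable_on_theta; use assms in auto)+
  also have "UNIV = ?E \<union> ?O" by auto
  also have "infsum t (?E \<union> ?O) = infsum t ?E + infsum t ?O"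
    by (intro infsum_Un_disjoint summable_on_subset_banach[OF ts]) auto
  also have "\<dots> = theta_series (p\<^sup>2) (x\<^sup>2) * theta_series (p\<^sup>2) (p * y\<^sup>2)
       - (x * y) * (theta_series (p\<^sup>2) (p * x\<^sup>2) * theta_series (p\<^sup>2) (p\<^sup>2 * y\<^sup>2))"
    unfolding E O using assms
    by (simp add: pu case_prod_unfold infsum_cmult_right' infsum_uminus)
  \<comment> \<open>Quasi-periodicity turns the argument p^2 y^2 into y^2, so that the same two
    functions occur for x and for y. This makes the result antisymmetric up to a factor x.\<close>
  also have "theta_series (p\<^sup>2) (p\<^sup>2 * y\<^sup>2) = theta_series (p\<^sup>2) (y\<^sup>2) / y\<^sup>2"
    using assms by (intro theta_series_quasi_periodic) auto
  finally show ?thesis using assms by (simp add: power2_eq_square)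
qed

lemma etheta_0: "etheta x 0 = 1 - x"
proof -
  have "etheta x 0 = (\<Prod>j. if j = 0 then 1 - x else 1)"
    unfolding etheta_def by (intro arg_cong[where f = prodinf]) (auto simp: fun_eq_iff)
  also have "\<dots> = 1 - x"
    using prodinf_finite[of "{0}" "\<lambda>j::nat. if j = 0 then 1 - x else 1"] by simp
  finally show ?thesis .
qed

lemma etheta_inverse:
  assumes "norm p < 1" "x \<noteq> 0"
  shows "etheta (1 / x) p = - etheta x p / x"
proof (cases "p = 0")
  case True
  then show ?thesis using assms by (simp add: etheta_0 field_simps)
next
  case False
  then obtain K where K: "\<And>x. x \<noteq> 0 \<Longrightarrow> etheta x p = K * theta_series p (- x)"
    using etheta_eq_theta_series assms by metis
  then show ?thesis using assms theta_series_reflect[of x p] by simp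
qed

text \<open>Inversion at its fixed point x = 1 reads theta(1) = -theta(1).\<close>

lemma etheta_1: "norm p < 1 \<Longrightarrow> etheta 1 p = 0"
  using etheta_inverse[of p 1] by simp

lemma etheta_addition:
  assumes "norm p < 1" "x \<noteq> 0" "y \<noteq> 0" "u \<noteq> 0" "v \<noteq> 0"
  shows "etheta (x * y) p * etheta (x / y) p * etheta (u * v) p * etheta (u / v) p
       - etheta (x * v) p * etheta (x / v) p * etheta (u * y) p * etheta (u / y) p
     = u / y * (etheta (y * v) p * etheta (y / v) p * etheta (x * u) p * etheta (x / u) p)"
proof -
  obtain f g where fg: "\<And>x y. x \<noteq> 0 \<Longrightarrow> y \<noteq> 0 \<Longrightarrow>
      etheta (x * y) p * etheta (x / y) p = x * (f x * g y - g x * f y)"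
  \<comment> \<open>For p = 0 the antisymmetric form is explicit: (1 - xy)(1 - x/y) = x((x + 1/x) -
    (y + 1/y)).\<close>
  proof (cases "p = 0")
    case True
    show ?thesis
      by (rule that[of "\<lambda>x. x + 1 / x" "\<lambda>x. 1"]) (auto simp: True etheta_0 field_simps)
  next
    case False
    then obtain K where K: "\<And>x. x \<noteq> 0 \<Longrightarrow> etheta x p = K * theta_series p (- x)"
      using etheta_eq_theta_series assms by metis
    show ?thesis
    proof (rule that[of "\<lambda>x. K\<^sup>2 * theta_series (p\<^sup>2) (x\<^sup>2) / x" "\<lambda>x. theta_series (p\<^sup>2) (p * x\<^sup>2)"])
      fix x y :: complex assume xy: "x \<noteq> 0" "y \<noteq> 0"
      have "etheta (x * y) p * etheta (x / y) p
          = K\<^sup>2 * (theta_series p (- (x * y)) * theta_series p (- (x / y)))"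
        using xy by (simp add: K power2_eq_square)
      also note theta_series_product[OF assms(1) False xy]
      finally show "etheta (x * y) p * etheta (x / y) p
          = x * (K\<^sup>2 * theta_series (p\<^sup>2) (x\<^sup>2) / x * theta_series (p\<^sup>2) (p * y\<^sup>2)
                - theta_series (p\<^sup>2) (p * x\<^sup>2) * (K\<^sup>2 * theta_series (p\<^sup>2) (y\<^sup>2) / y))"
        using xy by (simp add: algebra_simps)
    qed
  qed
  define F where "F = (\<lambda>x y. etheta (x * y) p * etheta (x / y) p)"
  have F: "F x y = x * (f x * g y - g x * f y)" if "x \<noteq> 0" "y \<noteq> 0" for x y
    using fg[OF that] by (simp add: F_def)
  \<comment> \<open>With [x,y] = f x g y - g x f y this is [x,y][u,v] - [x,v][u,y] = [y,v][x,u],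
    multiplied by x u = (u/y) y x.\<close>
  have "F x y * F u v - F x v * F u y = u / y * (F y v * F x u)"
    unfolding F[OF assms(2,3)] F[OF assms(4,5)] F[OF assms(2,5)] F[OF assms(4,3)]
      F[OF assms(3,5)] F[OF assms(2,4)]
    using assms(3) by (simp add: field_simps)
  then show ?thesis by (simp add: F_def mult.assoc)
qed

section \<open>The elliptic binomial theorem\<close>

locale elliptic_base =
  fixes p q :: complex
  assumes norm_p: "norm p < 1" and q_nz: "q \<noteq> 0"
begin

abbreviation \<theta> :: "complex \<Rightarrow> complex" where "\<theta> x \<equiv> etheta x p"
abbreviation poch :: "complex \<Rightarrow> nat \<Rightarrow> complex" where "poch x n \<equiv> epoch x q p n"

section \<open>Shifted factorials and the gamma function of a lattice\<close>

lemma poch_0 [simp]: "poch x 0 = 1"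
  by (simp add: epoch_def)

lemma poch_Suc: "poch x (Suc n) = poch x n * \<theta> (x * q ^ n)"
  by (simp add: epoch_def)

lemma poch_add: "poch x (m + n) = poch x m * poch (x * q ^ m) n"
  by (induction n) (simp_all add: poch_Suc power_add mult_ac)

text \<open>An elliptic gamma function on the lattice \<open>x q\<^sup>\<int>\<close>, so that
  \<open>(x q\<^sup>m)\<^sub>n = G (m + n) / G m\<close>. Vanishing factors are replaced by \<open>1\<close>, which makes
  every value nonzero.\<close>

definition fac :: "complex \<Rightarrow> int \<Rightarrow> complex" where
  "fac x i = (if \<theta> (x * q powi i) = 0 then 1 else \<theta> (x * q powi i))"

definition gam :: "complex \<Rightarrow> int \<Rightarrow> complex" where
  "gam x m = (if m \<ge> 0 then \<Prod>i<nat m. fac x (int i) else 1 / (\<Prod>i<nat (- m). fac x (- int i - 1)))"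

lemma fac_nz [simp]: "fac x i \<noteq> 0"
  by (simp add: fac_def)

lemma gam_nz [simp]: "gam x m \<noteq> 0"
  by (simp add: gam_def)

lemma gam_0 [simp]: "gam x 0 = 1"
  by (simp add: gam_def)

lemma gam_add_1: "gam x (m + 1) = fac x m * gam x m"
proof (cases "m \<ge> 0")
  case True
  then have "nat (m + 1) = Suc (nat m)" by simp
  then show ?thesis using True by (simp add: gam_def)
next
  case False
  define n where "n = nat (- m - 1)"
  have m: "m = - int n - 1" using False by (simp add: n_def)
  have "nat (- m) = Suc n" by (simp add: m)
  moreover have "gam x (m + 1) = 1 / (\<Prod>i<n. fac x (- int i - 1))"
    by (cases "n = 0") (simp_all add: gam_def m)
  ultimately show ?thesis by (simp add: gam_def m)
qed

text \<open>Change of base point on the lattice. It needs no genericity, because \<open>fac\<close>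
  depends only on the point x q^i, and not on x and i separately.\<close>

lemma gam_shift: "gam (x * q powi r) m = gam x (m + r) / gam x r"
proof (induction m rule: int_induct[where k = 0])
  case (step1 m)
  have "fac (x * q powi r) m = fac x (m + r)"
    using q_nz by (simp add: fac_def power_int_add mult_ac)
  then show ?case using step1 gam_add_1[of "x * q powi r" m] gam_add_1[of x "m + r"]
    by (simp add: algebra_simps)
next
  case (step2 m)
  have "fac (x * q powi r) (m - 1) = fac x (m - 1 + r)"
    using q_nz by (simp add: fac_def power_int_add power_int_diff mult_ac)
  then show ?case using step2 gam_add_1[of "x * q powi r" "m - 1"] gam_add_1[of x "m - 1 + r"]
    by (simp add: field_simps)
qed simp

text \<open>On a window of nonzero theta values the default 1 in \<open>fac\<close> never applies,
  so the quotient of \<open>gam\<close> telescopes to the true symbol.\<close>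

lemma poch_eq_gam:
  assumes "\<And>i. m \<le> i \<Longrightarrow> i < m + int n \<Longrightarrow> \<theta> (x * q powi i) \<noteq> 0"
  shows "poch (x * q powi m) n = gam x (m + int n) / gam x m"
  using assms
proof (induction n)
  case (Suc n)
  have "\<theta> (x * q powi m * q ^ n) = \<theta> (x * q powi (m + int n))"
    using q_nz by (simp add: power_int_add mult.assoc)
  moreover have "fac x (m + int n) = \<theta> (x * q powi (m + int n))"
    using Suc.prems[of "m + int n"] by (simp add: fac_def)
  moreover have "gam x (m + int (Suc n)) = fac x (m + int n) * gam x (m + int n)"
    using gam_add_1[of x "m + int n"] by (simp add: algebra_simps)
  ultimately show ?case using Suc by (simp add: poch_Suc)
qed simp

lemma theta_reflect:
  assumes "x \<noteq> 0"
  shows "\<theta> (q powi m / x) = - (q powi m / x) * \<theta> (x * q powi (- m))"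
proof -
  have "\<theta> (1 / (x * q powi (- m))) = - \<theta> (x * q powi (- m)) / (x * q powi (- m))"
    using assms q_nz by (intro etheta_inverse norm_p) auto
  then show ?thesis by (simp add: power_int_minus field_simps)
qed

lemma tri_Suc: "int (tri (int (Suc n))) = int (tri (int n)) + int n"
  using double_tri[of "int n"] double_tri[of "int (Suc n)"] by (simp add: algebra_simps)

text \<open>Inverting each factor by \<open>theta_reflect\<close> turns a symbol in 1/x into one in
  x, read downwards along the lattice. The signs and powers of q gather in the monomial in
  front.\<close>

lemma poch_reflect:
  assumes "x \<noteq> 0" "\<And>i. 1 - m - int n \<le> i \<Longrightarrow> i < 1 - m \<Longrightarrow> \<theta> (x * q powi i) \<noteq> 0"
  shows "poch (q powi m / x) n = (- (1 / x)) ^ n * q powi (m * int n + int (tri (int n)))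
    * (gam x (1 - m) / gam x (1 - m - int n))"
  using assms(2)
proof (induction n)
  case 0
  show ?case by (simp add: tri_def)
next
  case (Suc n)
  have e: "q powi m / x * q ^ n = q powi (m + int n) / x"
    using q_nz by (simp add: power_int_add)
  have 1: "\<theta> (q powi m / x * q ^ n) = - (1 / x) * q powi (m + int n) * \<theta> (x * q powi (- m - int n))"
    unfolding e using theta_reflect[OF assms(1), of "m + int n"] by simp
  have "fac x (- m - int n) = \<theta> (x * q powi (- m - int n))"
    using Suc.prems[of "- m - int n"] by (simp add: fac_def)
  then have 2: "gam x (1 - m - int n) = \<theta> (x * q powi (- m - int n)) * gam x (1 - m - int (Suc n))"
    using gam_add_1[of x "- m - int n"] by (simp add: algebra_simps)
  have 3: "q powi (m * int (Suc n) + int (tri (int (Suc n))))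
      = q powi (m * int n + int (tri (int n))) * q powi (m + int n)"
    using q_nz unfolding tri_Suc by (simp add: power_int_add[symmetric] algebra_simps)
  have nz: "\<theta> (x * q powi (- m - int n)) \<noteq> 0" using Suc.prems[of "- m - int n"] by simp
  have IH: "poch (q powi m / x) n = (- (1 / x)) ^ n * q powi (m * int n + int (tri (int n)))
    * (gam x (1 - m) / gam x (1 - m - int n))"
    by (rule Suc.IH) (rule Suc.prems, auto)
  show ?case unfolding poch_Suc IH 1 2 3 using nz by (simp add: mult_ac)
qed

text \<open>Restricting i to a finite window keeps this an open condition on the parameters, while
  any fixed N involves only finitely many i.\<close>

definition nz :: "nat \<Rightarrow> complex \<Rightarrow> bool" where
  "nz M x \<longleftrightarrow> (\<forall>i. \<bar>i\<bar> \<le> int M \<longrightarrow> \<theta> (x * q powi i) \<noteq> 0)"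

lemma nzD: "nz M x \<Longrightarrow> \<bar>i\<bar> \<le> int M \<Longrightarrow> \<theta> (x * q powi i) \<noteq> 0"
  by (simp add: nz_def)

lemma nzD_nat: "nz M x \<Longrightarrow> i \<le> M \<Longrightarrow> \<theta> (x * q ^ i) \<noteq> 0"
  using nzD[of M x "int i"] by simp

lemma nz_shift:
  assumes "nz M x" "\<bar>r\<bar> + int n \<le> int M"
  shows "nz n (x * q powi r)"
proof -
  have "\<theta> (x * q powi r * q powi i) = \<theta> (x * q powi (r + i))" for i
    using q_nz by (simp add: power_int_add mult.assoc)
  then show ?thesis using assms by (auto simp: nz_def)
qed

lemma gam_step:
  assumes "nz M x" "\<bar>m\<bar> \<le> int M"
  shows "gam x (m + 1) = \<theta> (x * q powi m) * gam x m"
  using assms gam_add_1[of x m] by (simp add: fac_def nz_def)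

lemma gam_step_nat:
  assumes "nz M x" "n \<le> M"
  shows "gam x (int (Suc n)) = \<theta> (x * q ^ n) * gam x (int n)"
  using gam_step[OF assms(1), of "int n"] assms(2) by (simp add: add.commute)

text \<open>The coefficient
  \<open>q\<^sup>k\<^sup>(\<^sup>k\<^sup>-\<^sup>n\<^sup>) (q)\<^sub>n / ((q)\<^sub>k (q)\<^sub>n\<^sub>-\<^sub>k) \<cdot> (a/c, acq\<^sup>n\<^sup>-\<^sup>k)\<^sub>k (a/b, abq\<^sup>k)\<^sub>n\<^sub>-\<^sub>k / ((bc)\<^sub>n (bq\<^sup>k\<^sup>-\<^sup>n/c)\<^sub>k (cq\<^sup>-\<^sup>k/b)\<^sub>n\<^sub>-\<^sub>k)\<close>
  rewritten in terms of \<open>gam\<close>, where it becomes well-poised in \<open>b/c\<close>.\<close>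

definition bincoef :: "nat \<Rightarrow> nat \<Rightarrow> complex \<Rightarrow> complex \<Rightarrow> complex \<Rightarrow> complex" where
  "bincoef n k a b c = (- (b / c)) ^ (n - k) * q powi (- int (tri (int n - int k)))
     * (poch q n / (poch q k * poch q (n - k)))
     * (gam (a / c) k * gam (a * c) n * gam (a / b) (int n - int k) * gam (a * b) n
        * gam (b / c) (int k - int n) * \<theta> (b / c * q powi (2 * int k - int n)))
     / (gam (a * c) (int n - int k) * gam (a * b) k * gam (b * c) n * gam (b / c) (int k + 1))"

text \<open>As functions of xi, the products theta(a xi) theta(a/xi) lie in a two-dimensional space.
  The addition formula at (a, xi, b, c) gives the coordinates in the basis belonging to b and
  c.\<close>

lemma theta_split:
  assumes "a \<noteq> 0" "b \<noteq> 0" "c \<noteq> 0" "\<xi> \<noteq> 0" "\<theta> (b * c) \<noteq> 0" "\<theta> (b / c) \<noteq> 0"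
  shows "\<theta> (a * \<xi>) * \<theta> (a / \<xi>)
    = \<theta> (a * c) * \<theta> (a / c) / (\<theta> (b * c) * \<theta> (b / c)) * (\<theta> (b * \<xi>) * \<theta> (b / \<xi>))
      + - (b / c) * (\<theta> (a * b) * \<theta> (a / b) / (\<theta> (b * c) * \<theta> (b / c))) * (\<theta> (c * \<xi>) * \<theta> (c / \<xi>))"
proof -
  have "\<theta> (1 / (c / \<xi>)) = - \<theta> (c / \<xi>) / (c / \<xi>)"
    by (rule etheta_inverse[OF norm_p]) (use assms in auto)
  then have r: "\<theta> (\<xi> / c) = - (\<xi> / c) * \<theta> (c / \<xi>)" by simp
  have "\<theta> (a * \<xi>) * \<theta> (a / \<xi>) * \<theta> (b * c) * \<theta> (b / c)
      = \<theta> (a * c) * \<theta> (a / c) * \<theta> (b * \<xi>) * \<theta> (b / \<xi>)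
        + b / \<xi> * (\<theta> (\<xi> * c) * \<theta> (\<xi> / c) * \<theta> (a * b) * \<theta> (a / b))"
    using etheta_addition[OF norm_p, of a \<xi> b c] assms by (simp add: algebra_simps)
  then show ?thesis using assms unfolding r by (simp add: field_simps)
qed

text \<open>The addition formula at \<open>x = a s q\<^sup>n\<close>, \<open>y = c/s\<close>, \<open>u = (b/s) q\<^sup>k\<^sup>-\<^sup>1\<^sup>-\<^sup>n\<close>, \<open>v = (c/s) q\<^sup>-\<^sup>k\<close> with \<open>s\<^sup>2 = bc\<close>.\<close>

lemma pascal_weights:
  fixes n k :: nat
  assumes "a \<noteq> 0" "b \<noteq> 0" "c \<noteq> 0"
    and "\<theta> (q ^ Suc n) \<noteq> 0" "\<theta> (a * c * q ^ n) \<noteq> 0" "\<theta> (a * b * q ^ n) \<noteq> 0"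
      "\<theta> (b / c * q powi (2 * int k - int n - 1)) \<noteq> 0"
  defines "D \<equiv> \<theta> (q ^ Suc n) * \<theta> (a * c * q ^ n) * \<theta> (a * b * q ^ n) * \<theta> (b / c * q powi (2 * int k - int n - 1))"
  shows "q powi int k * \<theta> (q powi (int n + 1 - int k)) * \<theta> (a * c * q powi (int n - int k))
        * \<theta> (a * b * q powi (int n + int k)) * \<theta> (b / c * q powi (int k - int n - 1)) / D
     + \<theta> (q powi int k) * \<theta> (a * b * q powi (int k - 1))
        * \<theta> (b / c * q powi int k) * \<theta> (a * c * q powi (2 * int n + 1 - int k)) / D = 1"
proof -
  \<comment> \<open>The square root centres the parameters, so that x y and x / y become multiples
    of a c and a b. Only s^2 = b c survives, hence the branch is irrelevant.\<close>
  define s where "s = csqrt (b * c)"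
  have s2: "s * s = b * c" unfolding s_def using power2_csqrt[of "b * c"] by (simp add: power2_eq_square)
  then have s0: "s \<noteq> 0" using assms by auto
  have q2: "q powi (int i * 2) = q ^ i * q ^ i" "q powi (2 * int i) = q ^ i * q ^ i" for i
  proof -
    have "q powi (int i + int i) = q ^ i * q ^ i" by (subst power_int_add) (use q_nz in auto)
    then show "q powi (int i * 2) = q ^ i * q ^ i" "q powi (2 * int i) = q ^ i * q ^ i"
      by (simp_all add: mult.commute)
  qed
  define x y u v where "x = a * s * q ^ n" and "y = c / s" and "u = b / s * q powi (int k - 1 - int n)"
    and "v = c / s * q powi (- int k)"
  have xy: "x * y = a * c * q ^ n" "x / y = a * b * q ^ n" "x * v = a * c * q powi (int n - int k)"
    "x / v = a * b * q powi (int n + int k)" "x * u = a * b * q powi (int k - 1)"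
    "x / u = a * c * q powi (2 * int n + 1 - int k)" "u * v = q powi (- int n - 1) / 1"
    "u / v = b / c * q powi (2 * int k - int n - 1)" "u * y = q powi (int k - int n - 1) / 1"
    "u / y = b / c * q powi (int k - int n - 1)"
    "y * v = q powi (- int k) / (b / c)" "y / v = q powi int k"
    using s0 s2 assms(1-3) q_nz
    by (simp_all add: x_def y_def u_def v_def power_int_add power_int_diff power_int_minus q2 field_simps)
  have r1: "\<theta> (q powi (- int n - 1) / 1) = - (q powi (- int n - 1)) * \<theta> (q ^ Suc n)"
    using theta_reflect[of 1 "- int n - 1"] q_nz by (simp add: power_int_add)
  have r2: "\<theta> (q powi (int k - int n - 1) / 1) = - (q powi (int k - int n - 1)) * \<theta> (q powi (int n + 1 - int k))"
    using theta_reflect[of 1 "int k - int n - 1"] by (simp add: algebra_simps)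
  have r3: "\<theta> (q powi (- int k) / (b / c)) = - (q powi (- int k) / (b / c)) * \<theta> (b / c * q powi int k)"
    using theta_reflect[of "b / c" "- int k"] assms by simp
  have "D - q powi int k * \<theta> (q powi (int n + 1 - int k)) * \<theta> (a * c * q powi (int n - int k))
        * \<theta> (a * b * q powi (int n + int k)) * \<theta> (b / c * q powi (int k - int n - 1))
     = - (q powi (int n + 1)) * (\<theta> (x * y) * \<theta> (x / y) * \<theta> (u * v) * \<theta> (u / v)
         - \<theta> (x * v) * \<theta> (x / v) * \<theta> (u * y) * \<theta> (u / y))"
  proof -
    have "q powi (int n + 1) * q powi (- int n - 1) = 1"
      "q powi (int n + 1) * q powi (int k - int n - 1) = q powi int k"
      using q_nz by (simp_all add: power_int_add[symmetric])
    moreover have "- Q * (A * B * (- e * t) * C - F * G * (- e' * w) * H)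
        = (Q * e) * (t * A * B * C) - (Q * e') * w * F * G * H"
      for Q A B e t C F G e' w H :: complex by (simp add: algebra_simps)
    ultimately show ?thesis unfolding xy r1 r2 D_def by simp
  qed
  also have "\<dots> = - (q powi (int n + 1)) * (u / y * (\<theta> (y * v) * \<theta> (y / v) * \<theta> (x * u) * \<theta> (x / u)))"
    using assms s0 q_nz
    by (subst etheta_addition[OF norm_p]) (auto simp: x_def y_def u_def v_def)
  also have "\<dots> = \<theta> (q powi int k) * \<theta> (a * b * q powi (int k - 1))
        * \<theta> (b / c * q powi int k) * \<theta> (a * c * q powi (2 * int n + 1 - int k))"
  proof -
    have h1: "q powi (int n + 1) * (b / c * q powi (int k - int n - 1)) * (q powi (- int k) / (b / c)) = 1"
      using assms q_nz by (simp add: power_int_add power_int_diff power_int_minus field_simps)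
    have h2: "- Q * (e * ((- e' * t) * A * B * C)) = (Q * e * e') * (A * B * t * C)"
      for Q e e' t A B C :: complex by (simp add: algebra_simps)
    show ?thesis unfolding xy r3 h2 h1 by simp
  qed
  finally have "q powi int k * \<theta> (q powi (int n + 1 - int k)) * \<theta> (a * c * q powi (int n - int k))
        * \<theta> (a * b * q powi (int n + int k)) * \<theta> (b / c * q powi (int k - int n - 1))
     + \<theta> (q powi int k) * \<theta> (a * b * q powi (int k - 1))
        * \<theta> (b / c * q powi int k) * \<theta> (a * c * q powi (2 * int n + 1 - int k)) = D"
    by (simp add: algebra_simps)
  moreover have "D \<noteq> 0" using assms by simp
  ultimately show ?thesis by (simp add: add_divide_distrib[symmetric])
qed

text \<open>\<open>wleft\<close> and \<open>wright\<close> are the shares of \<open>bincoef (n + 1) k\<close> contributed by \<open>bincoef n k\<close> and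
  \<open>bincoef n (k - 1)\<close> in the Pascal recurrence.\<close>

definition pden :: "nat \<Rightarrow> nat \<Rightarrow> complex \<Rightarrow> complex \<Rightarrow> complex \<Rightarrow> complex" where
  "pden n k a b c = \<theta> (q ^ Suc n) * \<theta> (a * c * q ^ n) * \<theta> (a * b * q ^ n)
     * \<theta> (b / c * q powi (2 * int k - int n - 1))"

definition wleft :: "nat \<Rightarrow> nat \<Rightarrow> complex \<Rightarrow> complex \<Rightarrow> complex \<Rightarrow> complex" where
  "wleft n k a b c = q powi int k * \<theta> (q powi (int n + 1 - int k)) * \<theta> (a * c * q powi (int n - int k))
        * \<theta> (a * b * q powi (int n + int k)) * \<theta> (b / c * q powi (int k - int n - 1)) / pden n k a b c"

definition wright :: "nat \<Rightarrow> nat \<Rightarrow> complex \<Rightarrow> complex \<Rightarrow> complex \<Rightarrow> complex" where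
  "wright n k a b c = \<theta> (q powi int k) * \<theta> (a * b * q powi (int k - 1))
        * \<theta> (b / c * q powi int k) * \<theta> (a * c * q powi (2 * int n + 1 - int k)) / pden n k a b c"

definition generic :: "nat \<Rightarrow> complex \<Rightarrow> complex \<Rightarrow> complex \<Rightarrow> bool" where
  "generic M a b c \<longleftrightarrow> a \<noteq> 0 \<and> b \<noteq> 0 \<and> c \<noteq> 0 \<and> (\<forall>i\<in>{1..M}. \<theta> (q ^ i) \<noteq> 0)
     \<and> nz M (a / b) \<and> nz M (a * b) \<and> nz M (a / c) \<and> nz M (a * c) \<and> nz M (b / c) \<and> nz M (b * c)"

lemma genericD:
  assumes "generic M a b c"
  shows "a \<noteq> 0" "b \<noteq> 0" "c \<noteq> 0" "\<And>i. 1 \<le> i \<Longrightarrow> i \<le> M \<Longrightarrow> \<theta> (q ^ i) \<noteq> 0"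
    "nz M (a / b)" "nz M (a * b)" "nz M (a / c)" "nz M (a * c)" "nz M (b / c)" "nz M (b * c)"
  using assms by (auto simp: generic_def)

lemma poch_q_nz:
  assumes "\<And>i. 1 \<le> i \<Longrightarrow> i \<le> M \<Longrightarrow> \<theta> (q ^ i) \<noteq> 0" "n \<le> M"
  shows "poch q n \<noteq> 0"
  unfolding epoch_def using assms(1)[of "Suc j" for j] assms(2) by (auto simp: prod_zero_iff)

lemma pascal_weights_add:
  assumes "generic M a b c" "n < M" "k \<le> Suc n"
  shows "wleft n k a b c + wright n k a b c = 1"
  unfolding wleft_def wright_def pden_def
proof (rule pascal_weights)
  note g = genericD[OF assms(1)]
  show "a \<noteq> 0" "b \<noteq> 0" "c \<noteq> 0" by (fact g)+
  show "\<theta> (q ^ Suc n) \<noteq> 0" by (rule g(4)) (use assms(2) in simp_all)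
  show "\<theta> (a * c * q ^ n) \<noteq> 0" "\<theta> (a * b * q ^ n) \<noteq> 0"
    by (rule nzD_nat, fact g, use assms(2) in simp)+
  show "\<theta> (b / c * q powi (2 * int k - int n - 1)) \<noteq> 0"
    by (rule nzD[OF g(9)]) (use assms(2,3) in linarith)
qed

text \<open>The factor in front of \<open>bincoef n k\<close> is the weight in
  \<open>theta_split\<close>, at the points a q^n, b q^k, c q^(n-k), of the term that lengthens the
  c-product and keeps k. What remains is a quotient of neighbouring coefficients, read off from the
  one-step rules of \<open>gam\<close>.\<close>

lemma bincoef_left:
  assumes "generic M a b c" "n < M" "k \<le> n"
  shows "- (b / c * q powi (2 * int k - int n))
      * (\<theta> (a * b * q powi (int n + int k)) * \<theta> (a / b * q powi (int n - int k))
         / (\<theta> (b * c * q powi int n) * \<theta> (b / c * q powi (2 * int k - int n)))) * bincoef n k a b c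
    = wleft n k a b c * bincoef (Suc n) k a b c"
proof -
  note g = genericD[OF assms(1)]
  obtain r where n: "n = k + r" using assms(3) le_Suc_ex by blast
  have nz: "\<theta> (b / c * q powi (2 * int k - int n)) \<noteq> 0" "\<theta> (b / c * q powi (2 * int k - int n - 1)) \<noteq> 0"
    "\<theta> (b * c * q powi int n) \<noteq> 0"
    "\<theta> (a * c * q ^ n) \<noteq> 0" "\<theta> (a * b * q ^ n) \<noteq> 0" "\<theta> (b / c * q powi (- int r - 1)) \<noteq> 0"
    "\<theta> (a * c * q ^ r) \<noteq> 0"
    by (rule nzD[OF g(9)] nzD[OF g(10)] g(4) nzD_nat[OF g(8)] nzD_nat[OF g(6)], use assms(2,3) n in linarith)+
  have nz': "\<theta> (q ^ Suc n) \<noteq> 0" "\<theta> (q ^ Suc r) \<noteq> 0"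
    by (rule g(4); use assms(2,3) n in linarith)+
  have "r < M" using assms(2) n by simp
  have i0: "int (Suc n) - int k = int (Suc r)" "int n - int k = int r" "int k - int n = - int r - 1 + 1"
    "int k - int (Suc n) = - int r - 1" "int r + 1 = int (Suc r)"
    by (simp_all add: n)
  have st: "gam (a * c) (int (Suc n)) = \<theta> (a * c * q ^ n) * gam (a * c) n"
    "gam (a * b) (int (Suc n)) = \<theta> (a * b * q ^ n) * gam (a * b) n"
    "gam (b * c) (int (Suc n)) = \<theta> (b * c * q powi int n) * gam (b * c) n"
    "gam (a / b) (int (Suc n) - int k) = \<theta> (a / b * q powi (int n - int k)) * gam (a / b) (int n - int k)"
    "gam (a * c) (int (Suc n) - int k) = \<theta> (a * c * q ^ r) * gam (a * c) (int n - int k)"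
    "gam (b / c) (int k - int n) = \<theta> (b / c * q powi (- int r - 1)) * gam (b / c) (int k - int (Suc n))"
    using gam_step_nat[OF g(8), of n] gam_step_nat[OF g(6), of n] gam_step_nat[OF g(10), of n]
      gam_step[OF g(5), of "int n - int k"] gam_step_nat[OF g(8), of r]
      gam_step[OF g(9), of "- int r - 1"] assms(2,3) \<open>r < M\<close>
    by (simp_all add: i0 del: of_nat_Suc)
  have q1: "poch q (Suc n) = poch q n * \<theta> (q ^ Suc n)" "poch q (Suc r) = poch q r * \<theta> (q ^ Suc r)"
    by (simp_all add: poch_Suc)
  have i1: "2 * int k - int (Suc n) = 2 * int k - int n - 1" "int k - int n - 1 = - int r - 1"
     "int n + 1 - int k = int (Suc r)" "n - k = r" "Suc n - k = Suc r" by (simp_all add: n)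
  have i2: "a * c * q powi (int n - int k) = a * c * q ^ r" "q powi (int (Suc r)) = q ^ Suc r"
    using q_nz by (simp_all add: n power_int_add)
  have tr: "int (tri (int (Suc n) - int k)) = int (tri (int n - int k)) + int r"
    using tri_Suc[of r] by (simp add: n algebra_simps)
  \<comment> \<open>The powers of q match because the triangular exponent grows by r = n -
    k.\<close>
  have qq: "q powi (2 * int k - int n) * q powi (- int (tri (int n - int k)))
     = q powi int k * q powi (- int (tri (int (Suc n) - int k)))"
  proof -
    have "2 * int k - int n + - int (tri (int n - int k)) = int k + - int (tri (int (Suc n) - int k))"
      unfolding tr by (simp add: n)
    then show ?thesis by (simp only: power_int_add[OF disjI1[OF q_nz], symmetric])
  qed
  define z1 z2 z3 z4 where "z1 = q powi (2 * int k - int n)" and "z2 = q powi (- int (tri (int n - int k)))"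
    and "z3 = q powi int k" and "z4 = q powi (- int (tri (int (Suc n) - int k)))"
  define w where "w = b / c"
  have zz: "z1 * z2 = z3 * z4" using qq by (simp add: z1_def z2_def z3_def z4_def)
  \<comment> \<open>Names make the theta values atoms of a rational identity, so that
    \<open>field_simps\<close> leaves their arguments alone.\<close>
  define t1 t2 t3 t4 t5 t6 t7 t8 t9 t10 t11 where "t1 = \<theta> (b / c * q powi (2 * int k - int n))"
    and "t2 = \<theta> (b / c * q powi (2 * int k - int n - 1))" and "t3 = \<theta> (b * c * q powi int n)"
    and "t4 = \<theta> (q ^ Suc n)" and "t5 = \<theta> (q ^ Suc r)" and "t6 = \<theta> (a * c * q ^ n)"
    and "t7 = \<theta> (a * b * q ^ n)" and "t8 = \<theta> (b / c * q powi (- int r - 1))" and "t9 = \<theta> (a * c * q ^ r)"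
    and "t10 = \<theta> (a * b * q powi (int n + int k))" and "t11 = \<theta> (a / b * q powi (int n - int k))"
  note td = t1_def[symmetric] t2_def[symmetric] t3_def[symmetric] t4_def[symmetric] t5_def[symmetric]
     t6_def[symmetric] t7_def[symmetric] t8_def[symmetric] t9_def[symmetric] t10_def[symmetric] t11_def[symmetric]
  have "- (w * z1) * (t10 * t11 / (t3 * t1)) *
     ((- w) ^ r * z2 * (poch q n / (poch q k * poch q r)) * (gam (a / c) k * gam (a * c) n * gam (a / b) (int n - int k) * gam (a * b) n
        * (t8 * gam (b / c) (int k - int (Suc n))) * t1) / (gam (a * c) (int n - int k) * gam (a * b) k * gam (b * c) n * gam (b / c) (int k + 1)))
     = z3 * t5 * t9 * t10 * t8 / (t4 * t6 * t7 * t2) *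
       ((- w) ^ Suc r * z4 * (poch q n * t4 / (poch q k * (poch q r * t5))) * (gam (a / c) k * (t6 * gam (a * c) n) * (t11 * gam (a / b) (int n - int k)) * (t7 * gam (a * b) n)
        * gam (b / c) (int k - int (Suc n)) * t2) / (t9 * gam (a * c) (int n - int k) * gam (a * b) k * (t3 * gam (b * c) n) * gam (b / c) (int k + 1)))"
    (is "?l = ?r")
  proof -
    have "?l = (z1 * z2) * (- w) ^ Suc r * (t10 * t11 * t8 * poch q n * gam (a / c) k * gam (a * c) n * gam (a / b) (int n - int k) * gam (a * b) n * gam (b / c) (int k - int (Suc n))
       / (t3 * poch q k * poch q r * gam (a * c) (int n - int k) * gam (a * b) k * gam (b * c) n * gam (b / c) (int k + 1)))"
      using nz nz' unfolding td by (simp add: field_simps)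
    also have "\<dots> = ?r"
      using nz nz' unfolding zz td by (simp add: field_simps)
    finally show ?thesis .
  qed
  then show ?thesis
    unfolding bincoef_def wleft_def pden_def st q1 i1 i2 t1_def t2_def t3_def t4_def t5_def t6_def t7_def
      t8_def t9_def t10_def t11_def z1_def z2_def z3_def z4_def w_def .
qed

text \<open>The companion weight: the b-product is lengthened and k moves to k + 1. As n - k does
  not change, the signs and powers of q in the two coefficients already agree.\<close>

lemma bincoef_right:
  assumes "generic M a b c" "n < M" "k \<le> n"
  shows "\<theta> (a * c * q powi (2 * int n - int k)) * \<theta> (a / c * q powi int k)
         / (\<theta> (b * c * q powi int n) * \<theta> (b / c * q powi (2 * int k - int n))) * bincoef n k a b c
    = wright n (Suc k) a b c * bincoef (Suc n) (Suc k) a b c"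
proof -
  note g = genericD[OF assms(1)]
  have nz: "\<theta> (b / c * q powi (2 * int k - int n)) \<noteq> 0" "\<theta> (b / c * q powi (2 * int k - int n + 1)) \<noteq> 0"
    "\<theta> (b * c * q powi int n) \<noteq> 0"
    "\<theta> (a * c * q ^ n) \<noteq> 0" "\<theta> (a * b * q ^ n) \<noteq> 0" "\<theta> (a * b * q ^ k) \<noteq> 0"
    "\<theta> (b / c * q powi (int k + 1)) \<noteq> 0"
    by (rule nzD[OF g(9)] nzD[OF g(10)] nzD_nat[OF g(8)] nzD_nat[OF g(6)], use assms(2,3) in linarith)+
  have nz': "\<theta> (q ^ Suc n) \<noteq> 0" "\<theta> (q ^ Suc k) \<noteq> 0"
    by (rule g(4); use assms(2,3) in linarith)+
  have Q: "poch q n \<noteq> 0" "poch q k \<noteq> 0" "poch q (n - k) \<noteq> 0"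
    using poch_q_nz[OF g(4)] assms by auto
  have st: "gam (a * c) (int (Suc n)) = \<theta> (a * c * q ^ n) * gam (a * c) n"
    "gam (a * b) (int (Suc n)) = \<theta> (a * b * q ^ n) * gam (a * b) n"
    "gam (b * c) (int (Suc n)) = \<theta> (b * c * q powi int n) * gam (b * c) n"
    "gam (a / c) (int (Suc k)) = \<theta> (a / c * q powi int k) * gam (a / c) k"
    "gam (a * b) (int (Suc k)) = \<theta> (a * b * q ^ k) * gam (a * b) k"
    "gam (b / c) (int (Suc k) + 1) = \<theta> (b / c * q powi (int k + 1)) * gam (b / c) (int k + 1)"
    using gam_step[OF g(8), of "int n"] gam_step[OF g(6), of "int n"] gam_step[OF g(10), of "int n"]
      gam_step[OF g(7), of "int k"] gam_step[OF g(6), of "int k"]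
      gam_step[OF g(9), of "int k + 1"] assms(2,3)
    by (simp_all add: algebra_simps)
  have q1: "poch q (Suc n) = poch q n * \<theta> (q ^ Suc n)" "poch q (Suc k) = poch q k * \<theta> (q ^ Suc k)"
    by (simp_all add: poch_Suc)
  have i1: "2 * int (Suc k) - int (Suc n) = 2 * int k - int n + 1" "2 * int (Suc k) - int n - 1 = 2 * int k - int n + 1"
     "int (Suc n) - int (Suc k) = int n - int k" "int (Suc k) - int (Suc n) = int k - int n"
     "int (Suc k) - 1 = int k" "2 * int n + 1 - int (Suc k) = 2 * int n - int k" "Suc n - Suc k = n - k"
    by simp_all
  have i2: "q powi int (Suc k) = q ^ Suc k" "b / c * q ^ Suc k = b / c * q powi (int k + 1)"
    "q powi int k = q ^ k"
    using q_nz by (simp_all add: power_int_add)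
  define t1 t2 t3 t4 t5 t6 t7 t8 t9 t10 t11 where "t1 = \<theta> (b / c * q powi (2 * int k - int n))"
    and "t2 = \<theta> (b / c * q powi (2 * int k - int n + 1))" and "t3 = \<theta> (b * c * q powi int n)"
    and "t4 = \<theta> (q ^ Suc n)" and "t5 = \<theta> (q ^ Suc k)" and "t6 = \<theta> (a * c * q ^ n)"
    and "t7 = \<theta> (a * b * q ^ n)" and "t8 = \<theta> (b / c * q powi (int k + 1))" and "t9 = \<theta> (a * b * q ^ k)"
    and "t10 = \<theta> (a * c * q powi (2 * int n - int k))" and "t11 = \<theta> (a / c * q ^ k)"
  note td = t1_def[symmetric] t2_def[symmetric] t3_def[symmetric] t4_def[symmetric] t5_def[symmetric]
     t6_def[symmetric] t7_def[symmetric] t8_def[symmetric] t9_def[symmetric] t10_def[symmetric] t11_def[symmetric]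
  show ?thesis
    using nz nz' Q unfolding bincoef_def wright_def pden_def st q1 i1 i2 td by (simp add: mult_ac)
qed

lemma eh_Suc: "eh q p a (Suc n) \<xi> = eh q p a n \<xi> * (\<theta> (a * q ^ n * \<xi>) * \<theta> (a * q ^ n / \<xi>))"
  by (simp add: eh_def poch_Suc mult_ac)

theorem elliptic_binomial:
  assumes "generic M a b c" "n \<le> M" "\<xi> \<noteq> 0"
  shows "eh q p a n \<xi> = (\<Sum>k\<le>n. bincoef n k a b c * eh q p b k \<xi> * eh q p c (n - k) \<xi>)"
  using assms(2)
proof (induction n)
  case 0
  have "bincoef 0 0 a b c = 1"
    using gam_step[of M "b / c" 0] nzD[of M "b / c" 0] genericD[OF assms(1)]
    by (simp add: bincoef_def tri_def)
  then show ?case by (simp add: eh_def)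
next
  case (Suc n)
  note g = genericD[OF assms(1)]
  let ?C = "\<lambda>n k. bincoef n k a b c" and ?L = "\<lambda>k. wleft n k a b c" and ?R = "\<lambda>k. wright n k a b c"
  let ?h = "\<lambda>k. eh q p b k \<xi> * eh q p c (Suc n - k) \<xi>"
  have step: "?C n k * eh q p b k \<xi> * eh q p c (n - k) \<xi> * (\<theta> (a * q ^ n * \<xi>) * \<theta> (a * q ^ n / \<xi>))
      = ?R (Suc k) * ?C (Suc n) (Suc k) * ?h (Suc k) + ?L k * ?C (Suc n) k * ?h k" if "k \<le> n" for k
  proof -
    have e: "a * q ^ n * (b * q ^ k) = a * b * q powi (int n + int k)"
      "a * q ^ n / (b * q ^ k) = a / b * q powi (int n - int k)"
      "b * q ^ k * (c * q ^ (n - k)) = b * c * q powi int n"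
      "b * q ^ k / (c * q ^ (n - k)) = b / c * q powi (2 * int k - int n)"
      "a * q ^ n * (c * q ^ (n - k)) = a * c * q powi (2 * int n - int k)"
      "a * q ^ n / (c * q ^ (n - k)) = a / c * q powi int k"
    proof -
      obtain r where n: "n = k + r" using \<open>k \<le> n\<close> le_Suc_ex by blast
      have "2 * int n - int k = int n + int r" by (simp add: n)
      then have "q powi (2 * int n - int k) = q powi (int n + int r)" by (simp only:)
      also have "\<dots> = q ^ n * q ^ r" using q_nz by (subst power_int_add) auto
      finally have q2: "q powi (2 * int n - int k) = q ^ n * q ^ r" .
      have "q powi (2 * int k - int n) = q powi (int k - int r)" by (simp add: n)
      also have "\<dots> = q ^ k / q ^ r" using q_nz by (subst power_int_diff) auto
      finally have q3: "q powi (2 * int k - int n) = q ^ k / q ^ r" .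
      show "a * q ^ n * (b * q ^ k) = a * b * q powi (int n + int k)"
        "a * q ^ n / (b * q ^ k) = a / b * q powi (int n - int k)"
        using q_nz by (simp_all add: power_int_add power_int_diff)
      show "b * q ^ k * (c * q ^ (n - k)) = b * c * q powi int n"
        "b * q ^ k / (c * q ^ (n - k)) = b / c * q powi (2 * int k - int n)"
        "a * q ^ n * (c * q ^ (n - k)) = a * c * q powi (2 * int n - int k)"
        "a * q ^ n / (c * q ^ (n - k)) = a / c * q powi int k"
        unfolding q2 q3 using q_nz by (simp_all add: n power_add power_int_add)
    qed
    have nz: "\<theta> (b * c * q powi int n) \<noteq> 0" "\<theta> (b / c * q powi (2 * int k - int n)) \<noteq> 0"
      by (rule nzD[OF g(9)] nzD[OF g(10)], use Suc.prems that in linarith)+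
    have hb: "eh q p b (Suc k) \<xi> = eh q p b k \<xi> * (\<theta> (b * q ^ k * \<xi>) * \<theta> (b * q ^ k / \<xi>))"
      by (rule eh_Suc)
    have hc: "eh q p c (Suc n - k) \<xi> = eh q p c (n - k) \<xi> * (\<theta> (c * q ^ (n - k) * \<xi>) * \<theta> (c * q ^ (n - k) / \<xi>))"
      using eh_Suc[of c "n - k"] that by (simp add: Suc_diff_le)
    have sp: "\<theta> (a * q ^ n * \<xi>) * \<theta> (a * q ^ n / \<xi>)
      = \<theta> (a * c * q powi (2 * int n - int k)) * \<theta> (a / c * q powi int k) / (\<theta> (b * c * q powi int n) * \<theta> (b / c * q powi (2 * int k - int n)))
          * (\<theta> (b * q ^ k * \<xi>) * \<theta> (b * q ^ k / \<xi>))
        + - (b / c * q powi (2 * int k - int n)) * (\<theta> (a * b * q powi (int n + int k)) * \<theta> (a / b * q powi (int n - int k)) / (\<theta> (b * c * q powi int n) * \<theta> (b / c * q powi (2 * int k - int n))))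
          * (\<theta> (c * q ^ (n - k) * \<xi>) * \<theta> (c * q ^ (n - k) / \<xi>))"
      using theta_split[of "a * q ^ n" "b * q ^ k" "c * q ^ (n - k)" \<xi>] g(1-3) q_nz assms(3) nz
      unfolding e by simp
    have "n < M" using Suc.prems by simp
    have dist: "C * h * h' * (X * T + Y * U) = (X * C) * (h * T * h') + (Y * C) * (h * (h' * U))"
      for C h h' X T Y U :: complex by (simp add: algebra_simps)
    show ?thesis
      unfolding sp dist bincoef_left[OF assms(1) \<open>n < M\<close> that] bincoef_right[OF assms(1) \<open>n < M\<close> that]
        hb hc diff_Suc_Suc ..
  qed
  have "eh q p a (Suc n) \<xi> = (\<Sum>k\<le>n. ?C n k * eh q p b k \<xi> * eh q p c (n - k) \<xi> * (\<theta> (a * q ^ n * \<xi>) * \<theta> (a * q ^ n / \<xi>)))"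
    unfolding eh_Suc using Suc by (simp add: sum_distrib_right)
  also have "\<dots> = (\<Sum>k\<le>n. ?R (Suc k) * ?C (Suc n) (Suc k) * ?h (Suc k)) + (\<Sum>k\<le>n. ?L k * ?C (Suc n) k * ?h k)"
    unfolding sum.distrib[symmetric] by (rule sum.cong) (use step in auto)
  \<comment> \<open>\<open>wright\<close> vanishes at k = 0 and \<open>wleft\<close> at k = n + 1,
    both through theta(1) = 0, so both sums extend to the range 0..n+1.\<close>
  also have "(\<Sum>k\<le>n. ?R (Suc k) * ?C (Suc n) (Suc k) * ?h (Suc k)) = (\<Sum>k\<le>Suc n. ?R k * ?C (Suc n) k * ?h k)"
    unfolding sum.atMost_Suc_shift[of _ n] by (simp add: wright_def etheta_1[OF norm_p])
  also have "(\<Sum>k\<le>n. ?L k * ?C (Suc n) k * ?h k) = (\<Sum>k\<le>Suc n. ?L k * ?C (Suc n) k * ?h k)"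
    by (simp add: wleft_def etheta_1[OF norm_p])
  also have "(\<Sum>k\<le>Suc n. ?R k * ?C (Suc n) k * ?h k) + (\<Sum>k\<le>Suc n. ?L k * ?C (Suc n) k * ?h k)
     = (\<Sum>k\<le>Suc n. (?L k + ?R k) * (?C (Suc n) k * ?h k))"
    by (simp add: sum.distrib[symmetric] algebra_simps del: sum.atMost_Suc)
  also have "\<dots> = (\<Sum>k\<le>Suc n. ?C (Suc n) k * eh q p b k \<xi> * eh q p c (Suc n - k) \<xi>)"
    by (rule sum.cong) (use pascal_weights_add[OF assms(1)] Suc.prems in auto)
  finally show ?case .
qed

end

section \<open>Connection coefficients\<close>

context elliptic_base
begin

lemma poch_eq_gam_0:
  assumes "nz M x" "n \<le> M"
  shows "poch x n = gam x (int n)"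
  using poch_eq_gam[of 0 n x] nzD[OF assms(1)] assms(2) by simp

text \<open>The bound is M + 1 because the last factor has index m + n - 1. The equation for
  \<open>y\<close> admits an argument written in any shape.\<close>

lemma poch_eq_gam_nz:
  assumes "nz M x" "- int M \<le> m" "m + int n \<le> int M + 1" "y = x * q powi m"
  shows "poch y n = gam x (m + int n) / gam x m"
  unfolding assms(4) by (rule poch_eq_gam, rule nzD[OF assms(1)]) (use assms(2,3) in linarith)

lemma poch_reflect_nz:
  assumes "nz M x" "x \<noteq> 0" "- int M \<le> 1 - m - int n" "- m \<le> int M" "y = q powi m / x"
  shows "poch y n = (- (1 / x)) ^ n * q powi (m * int n + int (tri (int n)))
    * (gam x (1 - m) / gam x (1 - m - int n))"
  unfolding assms(5) by (rule poch_reflect[OF assms(2)], rule nzD[OF assms(1)]) (use assms(3,4) in linarith)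

text \<open>The base 1 never satisfies \<open>nz\<close>, as theta(1) = 0. A direct induction meets
  only theta(q^i) with i >= 1 and yields the factorials \<open>poch q\<close> that occur in
  \<open>bincoef\<close>.\<close>

lemma poch_neg_power:
  assumes "\<And>i. 1 \<le> i \<Longrightarrow> i \<le> M \<Longrightarrow> \<theta> (q ^ i) \<noteq> 0" "j \<le> k" "k \<le> M"
  shows "poch (q powi (- int k)) j
    = (- 1) ^ j * q powi (- int k * int j + int (tri (int j))) * (poch q k / poch q (k - j))"
  using assms(2)
proof (induction j)
  case 0
  then show ?case using poch_q_nz[OF assms(1,3)] by (simp add: tri_def)
next
  case (Suc j)
  then obtain r where k: "k = Suc (j + r)" using less_imp_Suc_add Suc_le_eq by metis
  have e: "q powi (- int k) * q ^ j = q powi (int j - int k) / 1"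
    using q_nz by (simp add: power_int_diff power_int_minus field_simps)
  have 1: "\<theta> (q powi (- int k) * q ^ j) = - (q powi (int j - int k)) * \<theta> (q ^ Suc r)"
    unfolding e using theta_reflect[of 1 "int j - int k"] q_nz by (simp add: k power_int_add mult.commute)
  have 2: "poch q (k - j) = poch q (k - Suc j) * \<theta> (q ^ Suc r)"
    by (simp add: k poch_Suc)
  have 3: "q powi (- int k * int (Suc j) + int (tri (int (Suc j))))
      = q powi (- int k * int j + int (tri (int j))) * q powi (int j - int k)"
    using q_nz unfolding tri_Suc by (simp add: power_int_add[symmetric] algebra_simps)
  have "\<theta> (q ^ Suc r) \<noteq> 0" by (rule assms(1)) (use assms(3) k in auto)
  moreover have "poch q (k - Suc j) \<noteq> 0" by (rule poch_q_nz[OF assms(1)]) (use assms(3) in auto)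
  moreover have IH: "poch (q powi (- int k)) j
    = (- 1) ^ j * q powi (- int k * int j + int (tri (int j))) * (poch q k / poch q (k - j))"
    using Suc by simp
  ultimately show ?case unfolding poch_Suc IH 1 2 3 by (simp add: mult_ac)
qed

text \<open>All that is not a theta value in \<open>connection_term\<close>: the signs and the
  powers of the parameters and of q produced by reflections and by \<open>bincoef\<close>. The
  parameters reduce to powers of \<open>v\<close> and \<open>w\<close>, leaving one equation between
  quadratic exponents of q.\<close>

lemma connection_monomial:
  fixes j k l N :: nat
  assumes "a \<noteq> 0" "b \<noteq> 0" "c \<noteq> 0" "d \<noteq> 0" "j \<le> k" "k \<le> N" "j \<le> l" "l \<le> N"
  defines "t \<equiv> \<lambda>n. int (tri (int n))" and "w \<equiv> - (1 / (c / b))"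
  shows "q powi (int l * (int l - int N))
      * ((w ^ (N - k) * q powi (0 * int (N - k) + t (N - k))) * (w ^ (N - l) * q powi (0 * int (N - l) + t (N - l))))
      / ((w ^ N * q powi (0 * int N + t N)) * ((- (1 / (c / d))) ^ (N - l) * q powi (- int l * int (N - l) + t (N - l))))
      * ((((- 1) ^ j * q powi (- int k * int j + t j)) * ((- (1 / (a * b))) ^ j * q powi ((1 - int N) * int j + t j))
          * ((- 1) ^ j * q powi (- int l * int j + t j)))
      / (((- (1 / (a / c))) ^ j * q powi ((1 - int k) * int j + t j)) * ((- (1 / (b / d))) ^ j * q powi ((1 - int l) * int j + t j))
          * ((- (1 / (b * d))) ^ j * q powi ((1 - int N) * int j + t j)) * ((- 1) ^ j * q powi (- int N * int j + t j))) * q ^ j)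
    = ((- (c / (b * q powi (int N - int k)))) ^ (k - j) * q powi (- t (k - j)))
      * ((- (c * q powi int j / d)) ^ (N - l) * q powi (- t (N - l)))
      * (w ^ (N - l) * q powi (- int j * int (N - l) + t (N - l)))"
    (is "?L = ?R")
proof -
  define v where "v = - (c / d)"
  have w0: "w \<noteq> 0" using assms by (simp add: w_def)
  have v0: "v \<noteq> 0" using assms by (simp add: v_def)
  define eL where "eL = int l * (int l - int N) + t (N - k) + t (N - l) - t N - (- int l * int (N - l) + t (N - l))
    + (- int k * int j + t j) + ((1 - int N) * int j + t j) + (- int l * int j + t j)
    - ((1 - int k) * int j + t j) - ((1 - int l) * int j + t j) - ((1 - int N) * int j + t j) - (- int N * int j + t j) + int j"
  define eR where "eR = (int k - int N) * int (k - j) - t (k - j) + int j * int (N - l) - t (N - l) + (- int j * int (N - l) + t (N - l))"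
  have td: "2 * t n = int n * (int n - 1)" for n unfolding t_def by (rule double_tri)
  have e: "eL = eR"
  proof -
    \<comment> \<open>Doubling clears the halves in \<open>tri\<close> and leaves a polynomial
      identity in j, k, l, N.\<close>
    have "2 * eL = 2 * eR"
      using td[of "N - k"] td[of N] td[of j] td[of "k - j"] assms(5-8)
      unfolding eL_def eR_def by (simp add: of_nat_diff algebra_simps)
    then show ?thesis by simp
  qed
  have z: "(- 1) ^ j * (- (1 / (a * b))) ^ j * (- 1) ^ j
     / ((- (1 / (a / c))) ^ j * (- (1 / (b / d))) ^ j * (- (1 / (b * d))) ^ j * (- 1) ^ j) = w ^ j"
    unfolding power_mult_distrib[symmetric] power_divide[symmetric] using assms(1-4)
    by (simp add: w_def field_simps)
  have zL: "?L = w ^ (N - k) * w ^ (N - l) / (w ^ N * (- (1 / (c / d))) ^ (N - l)) *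
     ((- 1) ^ j * (- (1 / (a * b))) ^ j * (- 1) ^ j
     / ((- (1 / (a / c))) ^ j * (- (1 / (b / d))) ^ j * (- (1 / (b * d))) ^ j * (- 1) ^ j)) * q powi eL"
    using q_nz unfolding eL_def
    by (simp only: power_int_add power_int_diff mult_zero_left add_0_left power_int_of_nat simp_thms)
       (simp add: mult_ac)
  have f1: "(- (1 / (c / d))) ^ (N - l) = 1 / v ^ (N - l)"
    unfolding power_one_over[symmetric] by (simp add: v_def)
  have f2: "w ^ N = w ^ (N - k) * w ^ (k - j) * w ^ j"
    using assms(5,6) by (simp add: power_add[symmetric])
  note zL
  also have "w ^ (N - k) * w ^ (N - l) / (w ^ N * (- (1 / (c / d))) ^ (N - l)) *
     ((- 1) ^ j * (- (1 / (a * b))) ^ j * (- 1) ^ j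
     / ((- (1 / (a / c))) ^ j * (- (1 / (b / d))) ^ j * (- (1 / (b * d))) ^ j * (- 1) ^ j)) * q powi eL
    = v ^ (N - l) * w ^ (N - l) / w ^ (k - j) * q powi eL"
    unfolding z f1 f2 using w0 v0 by simp
  finally have L: "?L = v ^ (N - l) * w ^ (N - l) / w ^ (k - j) * q powi eL" .
  have pw: "(q powi i) ^ n = q powi (i * int n)" for i n
    by (simp add: power_int_mult)
  have "- (c / (b * q powi (int N - int k))) = (1 / w) * q powi (int k - int N)"
    using assms q_nz by (simp add: w_def power_int_diff field_simps)
  then have x1: "(- (c / (b * q powi (int N - int k)))) ^ (k - j) = q powi ((int k - int N) * int (k - j)) / w ^ (k - j)"
    by (simp only: power_mult_distrib power_one_over pw) simp
  have "- (c * q powi int j / d) = v * q powi int j" by (simp add: v_def)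
  then have x2: "(- (c * q powi int j / d)) ^ (N - l) = v ^ (N - l) * q powi (int j * int (N - l))"
    by (simp only: power_mult_distrib pw)
  have R: "?R = v ^ (N - l) * w ^ (N - l) / w ^ (k - j) * q powi eR"
    unfolding x1 x2 unfolding eR_def diff_conv_add_uminus power_int_add[OF disjI1[OF q_nz]]
    by (simp add: divide_inverse mult_ac)
  show ?thesis unfolding L R e ..
qed

text \<open>The conditions on c c and d/c serve the evaluation points of the uniqueness proof, the
  remaining ones the expansion.\<close>

definition generic4 :: "nat \<Rightarrow> complex \<Rightarrow> complex \<Rightarrow> complex \<Rightarrow> complex \<Rightarrow> bool" where
  "generic4 M a b c d \<longleftrightarrow> a \<noteq> 0 \<and> b \<noteq> 0 \<and> c \<noteq> 0 \<and> d \<noteq> 0 \<and> (\<forall>i\<in>{1..M}. \<theta> (q ^ i) \<noteq> 0)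
     \<and> nz M (a / b) \<and> nz M (a * b) \<and> nz M (a / c) \<and> nz M (a * c) \<and> nz M (b / c) \<and> nz M (c / b) \<and> nz M (b * c)
     \<and> nz M (b / d) \<and> nz M (b * d) \<and> nz M (c / d) \<and> nz M (d / c) \<and> nz M (c * d) \<and> nz M (c * c)"

lemma generic4D:
  assumes "generic4 M a b c d"
  shows "a \<noteq> 0" "b \<noteq> 0" "c \<noteq> 0" "d \<noteq> 0" "\<And>i. 1 \<le> i \<Longrightarrow> i \<le> M \<Longrightarrow> \<theta> (q ^ i) \<noteq> 0"
    "nz M (a / b)" "nz M (a * b)" "nz M (a / c)" "nz M (a * c)" "nz M (b / c)" "nz M (c / b)" "nz M (b * c)"
    "nz M (b / d)" "nz M (b * d)" "nz M (c / d)" "nz M (d / c)" "nz M (c * d)" "nz M (c * c)"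
  using assms by (auto simp: generic4_def)

text \<open>The summand of index \<open>j\<close> of the very-well-poised series, with its prefactor, is the product of
  two binomial coefficients.\<close>

lemma connection_term:
  fixes j k l N :: nat
  assumes "generic4 M a b c d" "2 * N < M" "j \<le> k" "k \<le> N" "j \<le> l" "l \<le> N"
  defines "A \<equiv> q powi (- int N) * c / b"
  shows "q powi (int l * (int l - int N))
     * poch q N / (poch q l * poch q (N - l))
     * (poch (a * c) k * poch (a / c) k
        * poch (q ^ (N - l) * b * d) l * poch (b / d) l
        * poch (b / c) (N - k) * poch (b / c) (N - l) * poch (b * c) (N - k))
     / (poch (q powi (int l - int N) * c / d) l * poch (q powi (- int l) * d / c) (N - l)
        * poch (c * d) N * poch (b / c) N * poch (b * c) l)
     * (\<theta> (A * q ^ (2 * j)) / \<theta> A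
        * (poch A j * poch (q powi (- int k)) j * poch (q powi (int k - int N) * a / b) j
           * poch (q powi (int l - int N) * c / d) j * poch (c * d) j
           * poch (q powi (1 - int N) / (a * b)) j * poch (q * c / b) j * poch (q powi (- int l)) j)
        / (poch q j * poch (A * q / q powi (- int k)) j * poch (A * q / (q powi (int k - int N) * a / b)) j
           * poch (A * q / (q powi (int l - int N) * c / d)) j * poch (A * q / (c * d)) j
           * poch (A * q / (q powi (1 - int N) / (a * b))) j
           * poch (A * q / (q * c / b)) j * poch (A * q ^ (l + 1)) j)
        * q ^ j)
   = bincoef k j a c (b * q powi (int N - int k)) * bincoef (N - j) (l - j) b (c * q powi int j) d"
proof -
  note g = generic4D[OF assms(1)]
  note le = assms(2-6)
  define w where "w = - (1 / (c / b))"
  define t where "t = (\<lambda>n. int (tri (int n)))"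
  have idf: "int (N - k) = int N - int k" "int (N - l) = int N - int l" "int (N - j) = int N - int j"
    "int (k - j) = int k - int j" "int (l - j) = int l - int j"
    using le by (auto simp: of_nat_diff)
  \<comment> \<open>Symbols in b/c, d/c and 1/(b d) are reflected onto these three bases, so that
    one gamma function serves each inverse pair.\<close>
  define H X Y where "H = gam (c / b)" and "X = gam (c / d)" and "Y = gam (b * d)"
  \<comment> \<open>Monomials split off by reflection: \<open>m5\<close> to \<open>m11\<close> from
    the prefactor, the \<open>n\<close> and \<open>d\<close> families from numerator and denominator
    of the series, the \<open>r\<close> family from the right-hand side.\<close>
  define m5 m6 m7 m11 where
      "m5 = w ^ (N - k) * q powi (0 * int (N - k) + t (N - k))"
    and "m6 = w ^ (N - l) * q powi (0 * int (N - l) + t (N - l))"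
    and "m7 = w ^ N * q powi (0 * int N + t N)"
    and "m11 = (- (1 / (c / d))) ^ (N - l) * q powi (- int l * int (N - l) + t (N - l))"
  define n1 n2 n3 d1 d2 d3 d4 where
      "n1 = (- 1) ^ j * q powi (- int k * int j + t j)"
    and "n2 = (- (1 / (a * b))) ^ j * q powi ((1 - int N) * int j + t j)"
    and "n3 = (- 1) ^ j * q powi (- int l * int j + t j)"
    and "d1 = (- (1 / (a / c))) ^ j * q powi ((1 - int k) * int j + t j)"
    and "d2 = (- (1 / (b / d))) ^ j * q powi ((1 - int l) * int j + t j)"
    and "d3 = (- (1 / (b * d))) ^ j * q powi ((1 - int N) * int j + t j)"
    and "d4 = (- 1) ^ j * q powi (- int N * int j + t j)"
  define r1 r2 r3 where
      "r1 = (- (c / (b * q powi (int N - int k)))) ^ (k - j) * q powi (- t (k - j))"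
    and "r2 = (- (c * q powi int j / d)) ^ (N - l) * q powi (- t (N - l))"
    and "r3 = w ^ (N - l) * q powi (- int j * int (N - l) + t (N - l))"
  have mono: "q powi (int l * (int l - int N)) * (m5 * m6) / (m7 * m11) * (n1 * n2 * n3 / (d1 * d2 * d3 * d4) * q ^ j)
      = r1 * r2 * r3"
    unfolding m5_def m6_def m7_def m11_def n1_def n2_def n3_def d1_def d2_def d3_def d4_def r1_def r2_def r3_def
      w_def t_def
    by (rule connection_monomial[OF g(1-4) le(2-5)])
  have mnz: "m7 \<noteq> 0" "m11 \<noteq> 0" "d1 \<noteq> 0" "d2 \<noteq> 0" "d3 \<noteq> 0" "d4 \<noteq> 0"
    using g(1-4) q_nz by (auto simp: m7_def m11_def d1_def d2_def d3_def d4_def w_def)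
  have Hnz: "H i \<noteq> 0" "X i \<noteq> 0" "Y i \<noteq> 0" for i by (simp_all add: H_def X_def Y_def)

  have p1: "poch (a * c) k = gam (a * c) k" by (rule poch_eq_gam_0[OF g(9)]) (use le in linarith)
  have p2: "poch (a / c) k = gam (a / c) k" by (rule poch_eq_gam_0[OF g(8)]) (use le in linarith)
  have p3: "poch (q ^ (N - l) * b * d) l = Y N / Y (int N - int l)"
  proof -
    have "poch (q ^ (N - l) * b * d) l = Y (int (N - l) + int l) / Y (int (N - l))"
      unfolding Y_def by (rule poch_eq_gam_nz[OF g(14)]; (use le idf in linarith | simp))
    then show ?thesis by (simp add: idf)
  qed
  have p4: "poch (b / d) l = gam (b / d) l" by (rule poch_eq_gam_0[OF g(13)]) (use le in linarith)
  have p5: "poch (b / c) n = w ^ n * q powi (0 * int n + t n) * (H 1 / H (1 - int n))" if "n \<le> N" for n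
    unfolding H_def w_def t_def
    by (subst poch_reflect_nz[OF g(11), of 0]) (use g le that in simp_all)
  have p8: "poch (b * c) n = gam (b * c) n" if "n \<le> N" for n
    by (rule poch_eq_gam_0[OF g(12)]) (use le that in linarith)
  have p10: "poch (q powi (int l - int N) * c / d) n = X (int l - int N + int n) / X (int l - int N)" if "n \<le> l" for n
    unfolding X_def by (rule poch_eq_gam_nz[OF g(15)]) (use le that in simp_all)
  have p11: "poch (q powi (- int l) * d / c) (N - l) = m11 * (X (1 + int l) / X (1 + 2 * int l - int N))"
    unfolding X_def m11_def t_def
    by (subst poch_reflect_nz[OF g(15), of "- int l"]) (use g le in \<open>simp_all add: idf algebra_simps\<close>)
  have p12: "poch (c * d) n = gam (c * d) n" if "n \<le> N" for n
    by (rule poch_eq_gam_0[OF g(17)]) (use le that in linarith)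

  have v0: "\<theta> (A * q ^ (2 * j)) = \<theta> (c / b * q powi (2 * int j - int N))"
  proof -
    have "A * q ^ (2 * j) = c / b * (q powi (- int N) * q powi int (2 * j))"
      unfolding power_int_of_nat by (simp add: A_def)
    also have "q powi (- int N) * q powi int (2 * j) = q powi (2 * int j - int N)"
      unfolding power_int_add[OF disjI1[OF q_nz], symmetric] by simp
    finally show ?thesis by simp
  qed
  have A: "A = c / b * q powi (- int N)" by (simp add: A_def)
  have v1: "\<theta> A = H (1 - int N) / H (- int N)"
    using gam_step[OF g(11), of "- int N"] le unfolding A H_def by simp
  have v2: "poch A j = H (int j - int N) / H (- int N)"
    unfolding H_def A by (subst poch_eq_gam_nz[OF g(11), of "- int N"]) (use le in simp_all)
  have v3: "poch (q powi (- int k)) j = n1 * (poch q k / poch q (k - j))"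
    unfolding n1_def t_def by (rule poch_neg_power[OF g(5)]) (use le in auto)
  have v4: "poch (q powi (int k - int N) * a / b) j = gam (a / b) (int k - int N + int j) / gam (a / b) (int k - int N)"
    by (rule poch_eq_gam_nz[OF g(6)]) (use le in simp_all)
  have v5: "poch (q powi (1 - int N) / (a * b)) j = n2 * (gam (a * b) N / gam (a * b) (int N - int j))"
    unfolding n2_def t_def
    by (subst poch_reflect_nz[OF g(7), of "1 - int N"]) (use g le in simp_all)
  have v6: "poch (q * c / b) j = H (int j + 1) / H 1"
    unfolding H_def by (subst poch_eq_gam_nz[OF g(11), of 1]) (use le in \<open>simp_all add: add.commute\<close>)
  have v7: "poch (q powi (- int l)) j = n3 * (poch q l / poch q (l - j))"
    unfolding n3_def t_def by (rule poch_neg_power[OF g(5)]) (use le in auto)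
  have v8: "poch (A * q / q powi (- int k)) j = H (int k + 1 - int N + int j) / H (int k + 1 - int N)"
    unfolding H_def A
    by (rule poch_eq_gam_nz[OF g(11)])
       (use le q_nz in \<open>simp_all add: power_int_add power_int_diff power_int_minus field_simps\<close>)
  have v9: "poch (A * q / (q powi (int k - int N) * a / b)) j = d1 * (gam (a / c) k / gam (a / c) (int k - int j))"
    unfolding d1_def t_def A
    by (subst poch_reflect_nz[OF g(8), of "1 - int k"])
       (use g le q_nz in \<open>simp_all add: power_int_add power_int_diff power_int_minus field_simps\<close>)
  have v10: "poch (A * q / (q powi (int l - int N) * c / d)) j = d2 * (gam (b / d) l / gam (b / d) (int l - int j))"
    unfolding d2_def t_def A
    by (subst poch_reflect_nz[OF g(13), of "1 - int l"])
       (use g le q_nz in \<open>simp_all add: power_int_add power_int_diff power_int_minus field_simps\<close>)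
  have v11: "poch (A * q / (c * d)) j = d3 * (Y N / Y (int N - int j))"
    unfolding d3_def t_def A Y_def
    by (subst poch_reflect_nz[OF g(14), of "1 - int N"])
       (use g le q_nz in \<open>simp_all add: power_int_add power_int_diff power_int_minus field_simps\<close>)
  have v12: "poch (A * q / (q powi (1 - int N) / (a * b))) j = gam (a * c) j"
  proof -
    have "A * q / (q powi (1 - int N) / (a * b)) = a * c"
      using g q_nz by (simp add: A power_int_diff power_int_minus field_simps)
    then show ?thesis using poch_eq_gam_0[OF g(9), of j] le by simp
  qed
  have v13: "poch (A * q / (q * c / b)) j = d4 * (poch q N / poch q (N - j))"
  proof -
    have "A * q / (q * c / b) = q powi (- int N)"
      using g q_nz by (simp add: A field_simps)
    then show ?thesis
      unfolding d4_def t_def using poch_neg_power[of M j N] g(5) le by simp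
  qed
  have v14: "poch (A * q ^ (l + 1)) j = H (int l + 1 - int N + int j) / H (int l + 1 - int N)"
    unfolding H_def A
    by (rule poch_eq_gam_nz[OF g(11)])
       (use le q_nz in \<open>simp_all add: power_int_add power_int_diff power_int_minus field_simps\<close>)

  define B' C' where "B' = b * q powi (int N - int k)" and "C' = c * q powi int j"
  note pid = power_int_add power_int_diff power_int_minus
  have B: "a / B' = a / b * q powi (int k - int N)" "a * B' = a * b * q powi (int N - int k)"
    "c / B' = c / b * q powi (int k - int N)" "c * B' = b * c * q powi (int N - int k)"
    using q_nz by (simp_all add: B'_def pid field_simps)
  have C: "b / C' = b / c * q powi (- int j)" "b * C' = b * c * q powi int j"
    "C' / d = c / d * q powi int j" "C' * d = c * d * q powi int j"
    using q_nz by (simp_all add: C'_def pid field_simps)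
  have s7: "\<theta> (c / b * q powi (int k - int N) * q powi (2 * int j - int k)) = \<theta> (c / b * q powi (2 * int j - int N))"
  proof -
    have "2 * int j - int N = (int k - int N) + (2 * int j - int k)" by simp
    then show ?thesis by (simp only: power_int_add[OF disjI1[OF q_nz]] mult.assoc)
  qed
  have b1: "bincoef k j a c B' = r1 * (poch q k / (poch q j * poch q (k - j)))
     * (gam (a / b) (int k - int N + int j) / gam (a / b) (int k - int N) * gam (a * b) N
        * gam (a / c) (int k - int j) * gam (a * c) k
        * H (int j - int N) * \<theta> (c / b * q powi (2 * int j - int N)))
     / (gam (a * b) (int N - int j) * gam (a * c) j * (gam (b * c) N / gam (b * c) (int N - int k))
        * H (int k + 1 - int N + int j))"
  proof -
    have ar: "int j + (int k - int N) = int k - int N + int j" "int k + (int N - int k) = int N"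
      "int k - int j + (int N - int k) = int N - int j" "int j - int k + (int k - int N) = int j - int N"
      "int j + 1 + (int k - int N) = int k + 1 - int N + int j"
      by simp_all
    have r1': "r1 = (- (c / B')) ^ (k - j) * q powi (- int (tri (int k - int j)))"
      by (simp add: r1_def B'_def t_def idf)
    show ?thesis
      unfolding bincoef_def r1'[symmetric] unfolding B gam_shift s7 ar H_def[symmetric] idf
      using Hnz by (simp add: mult_ac)
  qed
  \<comment> \<open>The only gamma function on the right in the base b/c. Inside the window it is a
    true symbol, and as such it can be reflected onto \<open>H\<close>.\<close>
  have u1: "gam (b / C') (int N - int l) = r3 * (H (int j + 1) / H (int l + 1 - int N + int j))"
  proof -
    have "nz N (b / C')" unfolding C by (rule nz_shift[OF g(10)]) (use le in simp)
    then have "gam (b / C') (int N - int l) = poch (b / C') (N - l)"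
      using poch_eq_gam_0[of N "b / C'" "N - l"] by (simp add: idf)
    also have "\<dots> = r3 * (H (1 - (- int j)) / H (1 - (- int j) - int (N - l)))"
      unfolding r3_def w_def t_def H_def
      by (rule poch_reflect_nz[OF g(11)]) (use g le q_nz in \<open>simp_all add: C idf\<close>)
    also have "1 - (- int j) - int (N - l) = int l + 1 - int N + int j" by (simp add: idf)
    finally show ?thesis by (simp add: add.commute)
  qed
  have u7: "\<theta> (c / d * q powi int j * q powi (2 * (int l - int j) - (int N - int j)))
     = X (1 + 2 * int l - int N) / X (2 * int l - int N)"
  proof -
    have "2 * int l - int N = int j + (2 * (int l - int j) - (int N - int j))" by simp
    then have e: "c / d * q powi int j * q powi (2 * (int l - int j) - (int N - int j)) = c / d * q powi (2 * int l - int N)"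
      by (simp only: power_int_add[OF disjI1[OF q_nz]] mult.assoc)
    have "X (2 * int l - int N + 1) = \<theta> (c / d * q powi (2 * int l - int N)) * X (2 * int l - int N)"
      unfolding X_def by (rule gam_step[OF g(15)]) (use le in linarith)
    moreover have "2 * int l - int N + 1 = 1 + 2 * int l - int N" by simp
    ultimately show ?thesis unfolding e using Hnz by simp
  qed
  have b2: "bincoef (N - j) (l - j) b C' d = r2 * (poch q (N - j) / (poch q (l - j) * poch q (N - l)))
     * (gam (b / d) (int l - int j) * Y (int N - int j) * (r3 * (H (int j + 1) / H (int l + 1 - int N + int j)))
        * gam (b * c) N * X (int l - int N + int j) * (X (1 + 2 * int l - int N) / X (2 * int l - int N)))
     / (Y (int N - int l) * gam (b * c) l * (gam (c * d) N / gam (c * d) j) * X (1 + int l))"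
  proof -
    have ar: "int N - int j - (int l - int j) = int N - int l" "int l - int j - (int N - int j) = int l - int N"
      "int l - int j + int j = int l" "int N - int j + int j = int N" "int l - int j + 1 + int j = 1 + int l"
      by simp_all
    have an: "N - j - (l - j) = N - l" using le by simp
    have r2': "r2 = (- (C' / d)) ^ (N - l) * q powi (- int (tri (int N - int l)))"
      by (simp add: r2_def C'_def t_def idf)
    show ?thesis
      unfolding bincoef_def an idf ar r2'[symmetric] u1
      unfolding C gam_shift u7 ar X_def[symmetric] Y_def[symmetric]
      using Hnz by (simp add: mult_ac)
  qed
  \<comment> \<open>What both sides have in common once the monomials are split off.\<close>
  define core where "core = poch q k * poch q (N - j) / (poch q j * poch q (k - j) * poch q (l - j) * poch q (N - l))
    * (gam (a * c) k * gam (a / c) (int k - int j) * gam (b / d) (int l - int j) * Y (int N - int j)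
       * gam (b * c) (int N - int k) * gam (a / b) (int k - int N + int j) * gam (a * b) N * gam (c * d) j
       * X (int l - int N + int j) * X (1 + 2 * int l - int N) * H (int j - int N) * H (int j + 1)
       * \<theta> (c / b * q powi (2 * int j - int N)))
    / (Y (int N - int l) * gam (b * c) l * gam (a * c) j * gam (a / b) (int k - int N) * gam (a * b) (int N - int j)
       * gam (c * d) N * X (1 + int l) * X (2 * int l - int N)
       * H (int k + 1 - int N + int j) * H (int l + 1 - int N + int j))"
  have R: "bincoef k j a c B' * bincoef (N - j) (l - j) b C' d = (r1 * r2 * r3) * core"
    unfolding b1 b2 core_def using Hnz by (simp add: field_simps)
  have Qnz: "poch q n \<noteq> 0" if "n \<le> N" for n
    using poch_q_nz[of M n] g(5) le that by simp
  have p10': "poch (q powi (int l - int N) * c / d) l = X (2 * int l - int N) / X (int l - int N)"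
    using p10[of l] by (simp add: algebra_simps)
  have i1: "1 - (int N - int k) = int k + 1 - int N" "1 - (int N - int l) = int l + 1 - int N" by simp_all
  have p5': "poch (b / c) (N - k) = m5 * (H 1 / H (int k + 1 - int N))"
    "poch (b / c) (N - l) = m6 * (H 1 / H (int l + 1 - int N))" "poch (b / c) N = m7 * (H 1 / H (1 - int N))"
    using p5[of "N - k"] p5[of "N - l"] p5[of N] unfolding m5_def m6_def m7_def idf i1 by simp_all
  show ?thesis
    unfolding B'_def[symmetric] C'_def[symmetric] R mono[symmetric] core_def
      p1 p2 p3 p4 p5' p8[OF diff_le_self] p8[OF le(5)] p10' p10[OF le(4)] p11 p12[OF order.refl] p12[OF order.trans[OF le(4,5)]]
      v0 v1 v2 v3 v4 v5 v6 v7 v8 v9 v10 v11 v12 v13 v14 idf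
    using Hnz mnz Qnz[of N] Qnz[of l] le by (simp add: field_simps)
qed


text \<open>The factor of index k is theta(1) = 0. This both ends the series beyond k and makes the
  evaluations in the uniqueness proof triangular.\<close>

lemma poch_neg_power_eq_0: "k < j \<Longrightarrow> poch (q powi (- int k)) j = 0"
proof -
  assume "k < j"
  have "\<theta> (q powi (- int k) * q ^ k) = 0"
    using q_nz etheta_1[OF norm_p] by (simp add: power_int_minus)
  then show ?thesis using \<open>k < j\<close> unfolding epoch_def by (auto intro!: prod_zero)
qed

lemma poch_nz:
  assumes "nz M x" "- int M \<le> m" "m + int n \<le> int M + 1" "y = x * q powi m"
  shows "poch y n \<noteq> 0"
  using poch_eq_gam_nz[OF assms] by simp

text \<open>The series is defined with j running to l; the factor (q^-k)_j cuts it off beyond k,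
  whence the condition j <= k.\<close>

lemma Rcoef_eq:
  assumes "generic4 M a b c d" "2 * N < M" "k \<le> N" "l \<le> N"
  shows "Rcoef a b c d N q p k l = (\<Sum>j\<le>l. if j \<le> k then
     bincoef k j a c (b * q powi (int N - int k)) * bincoef (N - j) (l - j) b (c * q powi int j) d else 0)"
  unfolding Rcoef_def V12_def sum_distrib_left
proof (rule sum.cong, goal_cases)
  case (2 j)
  show ?case
  proof (cases "j \<le> k")
    case True
    then show ?thesis using connection_term[OF assms(1,2) True assms(3) _ assms(4)] 2 by simp
  next
    case False
    then have "poch (q powi (- int k)) j = 0" by (simp add: poch_neg_power_eq_0)
    then show ?thesis using False by simp
  qed
qed simp

lemma eh_add: "eh q p a (m + n) \<xi> = eh q p a m \<xi> * eh q p (a * q ^ m) n \<xi>"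
  by (simp add: eh_def poch_add mult_ac)

lemma connection:
  assumes "generic4 M a b c d" "2 * N < M" "k \<le> N" "\<xi> \<noteq> 0"
  shows "eh q p a k \<xi> * eh q p b (N - k) \<xi>
    = (\<Sum>l\<le>N. Rcoef a b c d N q p k l * eh q p c l \<xi> * eh q p d (N - l) \<xi>)"
proof -
  note g = generic4D[OF assms(1)]
  define T1 where "T1 = (\<lambda>j. bincoef k j a c (b * q powi (int N - int k)))"
  define T2 where "T2 = (\<lambda>j l. bincoef (N - j) (l - j) b (c * q powi int j) d)"
  define h where "h = (\<lambda>l. eh q p c l \<xi> * eh q p d (N - l) \<xi>)"
  have pid: "b * q powi (int N - int k) = b * q ^ (N - k)"
    using assms(3) by (simp add: of_nat_diff[symmetric] del: of_nat_diff)
  \<comment> \<open>Shifting a base by at most q^N still leaves a window of size N, because M > 2N.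
    The same count serves \<open>g2\<close>.\<close>
  have g1: "generic N a c (b * q powi (int N - int k))"
  proof -
    have e: "a / (b * q powi (int N - int k)) = a / b * q powi (int k - int N)"
      "a * (b * q powi (int N - int k)) = a * b * q powi (int N - int k)"
      "c / (b * q powi (int N - int k)) = c / b * q powi (int k - int N)"
      "c * (b * q powi (int N - int k)) = b * c * q powi (int N - int k)"
      using q_nz by (simp_all add: power_int_diff field_simps)
    have n: "nz N x" if "nz M x" for x using nz_shift[OF that, of 0 N] assms(2) by simp
    have "nz N (x * q powi i)" if "nz M x" "\<bar>i\<bar> \<le> int N" for x i
      by (rule nz_shift[OF that(1)]) (use that assms(2) in simp)
    then have "nz N (a / (b * q powi (int N - int k)))" "nz N (a * (b * q powi (int N - int k)))"
      "nz N (c / (b * q powi (int N - int k)))" "nz N (c * (b * q powi (int N - int k)))"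
      unfolding e using g(6,7,11,12) assms(3) by (simp_all del: times_divide_eq_left)
    then show ?thesis unfolding generic_def using n g q_nz assms(2) by auto
  qed
  have g2: "generic (N - j) b (c * q powi int j) d" if "j \<le> N" for j
  proof -
    have e: "b / (c * q powi int j) = b / c * q powi (- int j)" "b * (c * q powi int j) = b * c * q powi int j"
      "c * q powi int j / d = c / d * q powi int j" "c * q powi int j * d = c * d * q powi int j"
      using q_nz by (simp_all add: power_int_minus field_simps)
    have n: "nz (N - j) x" if "nz M x" for x using nz_shift[OF that, of 0 "N - j"] assms(2) by simp
    have "nz (N - j) (x * q powi i)" if "nz M x" "\<bar>i\<bar> \<le> int N" for x i
      by (rule nz_shift[OF that(1)]) (use that assms(2) in simp)
    then have "nz (N - j) (b / (c * q powi int j))" "nz (N - j) (b * (c * q powi int j))"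
      "nz (N - j) (c * q powi int j / d)" "nz (N - j) (c * q powi int j * d)"
      unfolding e using g(10,12,15,17) that by (simp_all del: times_divide_eq_left power_int_of_nat)
    then show ?thesis unfolding generic_def using n g q_nz assms(2) by auto
  qed
  have inner: "eh q p c j \<xi> * eh q p b (N - j) \<xi> = (\<Sum>l\<le>N. if j \<le> l then T2 j l * h l else 0)" if "j \<le> N" for j
  proof -
    have "eh q p c j \<xi> * eh q p b (N - j) \<xi>
       = (\<Sum>i\<le>N - j. eh q p c j \<xi> * (bincoef (N - j) i b (c * q powi int j) d * eh q p (c * q powi int j) i \<xi> * eh q p d (N - j - i) \<xi>))"
      using elliptic_binomial[OF g2[OF that] order.refl assms(4)] by (simp add: sum_distrib_left)
    also have "\<dots> = (\<Sum>i\<le>N - j. T2 j (j + i) * h (j + i))"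
      by (rule sum.cong) (auto simp: T2_def h_def eh_add)
    also have "\<dots> = (\<Sum>l\<in>{j..N}. T2 j l * h l)"
      by (rule sum.reindex_bij_witness[where i = "\<lambda>l. l - j" and j = "\<lambda>i. j + i"]) (use that in auto)
    also have "\<dots> = (\<Sum>l\<le>N. if j \<le> l then T2 j l * h l else 0)"
      by (rule sum.mono_neutral_cong_left) auto
    finally show ?thesis .
  qed
  have "eh q p a k \<xi> * eh q p b (N - k) \<xi>
      = (\<Sum>j\<le>k. T1 j * eh q p c j \<xi> * (eh q p b (N - k) \<xi> * eh q p (b * q ^ (N - k)) (k - j) \<xi>))"
    using elliptic_binomial[OF g1 assms(3,4)] unfolding T1_def pid
    by (simp add: sum_distrib_left sum_distrib_right mult_ac)
  also have "\<dots> = (\<Sum>j\<le>k. T1 j * (eh q p c j \<xi> * eh q p b (N - j) \<xi>))"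
    by (rule sum.cong) (use assms(3) in \<open>auto simp: eh_add[symmetric]\<close>)
  also have "\<dots> = (\<Sum>j\<le>k. \<Sum>l\<le>N. if j \<le> l then T1 j * T2 j l * h l else 0)"
    by (rule sum.cong) (use assms(3) in \<open>auto simp: inner sum_distrib_left mult.assoc intro!: sum.cong\<close>)
  also have "\<dots> = (\<Sum>l\<le>N. \<Sum>j\<le>k. if j \<le> l then T1 j * T2 j l * h l else 0)"
    by (rule sum.swap)
  also have "\<dots> = (\<Sum>l\<le>N. (\<Sum>j\<le>l. if j \<le> k then T1 j * T2 j l else 0) * h l)"
  proof (rule sum.cong)
    fix l assume "l \<in> {..N}"
    have "(\<Sum>j\<le>k. if j \<le> l then T1 j * T2 j l * h l else 0) = (\<Sum>j\<in>{..k} \<inter> {..l}. T1 j * T2 j l * h l)"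
      by (rule sum.mono_neutral_cong_right) auto
    also have "\<dots> = (\<Sum>j\<le>l. if j \<le> k then T1 j * T2 j l * h l else 0)"
      by (rule sum.mono_neutral_cong_left) auto
    also have "\<dots> = (\<Sum>j\<le>l. if j \<le> k then T1 j * T2 j l else 0) * h l"
      unfolding sum_distrib_right by (rule sum.cong) auto
    finally show "(\<Sum>j\<le>k. if j \<le> l then T1 j * T2 j l * h l else 0) = (\<Sum>j\<le>l. if j \<le> k then T1 j * T2 j l else 0) * h l" .
  qed simp
  also have "\<dots> = (\<Sum>l\<le>N. Rcoef a b c d N q p k l * eh q p c l \<xi> * eh q p d (N - l) \<xi>)"
    unfolding T1_def T2_def h_def
    by (rule sum.cong) (use Rcoef_eq[OF assms(1-3)] in \<open>auto simp: mult.assoc\<close>)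
  finally show ?thesis .
qed

text \<open>At xi = q^-m/c the product h_l(x;c) contains theta(1) for every l > m, and the terms
  with l < m vanish by induction. This isolates \<open>D m\<close>, whose cofactor is nonzero by
  genericity.\<close>

lemma products_independent:
  assumes "generic4 M a b c d" "2 * N < M"
    and "\<And>\<xi>. \<xi> \<noteq> 0 \<Longrightarrow> (\<Sum>l\<le>N. D l * eh q p c l \<xi> * eh q p d (N - l) \<xi>) = 0"
  shows "m \<le> N \<Longrightarrow> D m = 0"
proof (induction m rule: less_induct)
  case (less m)
  note g = generic4D[OF assms(1)]
  define \<xi> where "\<xi> = q powi (- int m) / c"
  have x0: "\<xi> \<noteq> 0" using g q_nz by (simp add: \<xi>_def)
  have e: "c * \<xi> = q powi (- int m)" "c / \<xi> = c * c * q powi int m" "d * \<xi> = d / c * q powi (- int m)"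
    "d / \<xi> = c * d * q powi int m"
    using g q_nz by (simp_all add: \<xi>_def power_int_minus field_simps)
  have "D l * eh q p c l \<xi> * eh q p d (N - l) \<xi> = 0" if "l \<in> {..N} - {m}" for l
  proof (cases "l < m")
    case True
    then show ?thesis using less.IH less.prems by simp
  next
    case False
    then have "m < l" using that by auto
    then show ?thesis unfolding eh_def e by (simp add: poch_neg_power_eq_0)
  qed
  then have "(\<Sum>l\<le>N. D l * eh q p c l \<xi> * eh q p d (N - l) \<xi>) = D m * eh q p c m \<xi> * eh q p d (N - m) \<xi>"
    using sum.remove[of "{..N}" m "\<lambda>l. D l * eh q p c l \<xi> * eh q p d (N - l) \<xi>"] less.prems
    by (simp add: sum.neutral)
  then have "D m * eh q p c m \<xi> * eh q p d (N - m) \<xi> = 0" using assms(3)[OF x0] by simp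
  moreover have "poch (q powi (- int m)) m \<noteq> 0"
    using poch_neg_power[of M m m] g(5) poch_q_nz[of M m] less.prems assms(2) q_nz by simp
  moreover have "poch (c * c * q powi int m) m \<noteq> 0"
    by (rule poch_nz[OF g(18), of "int m"]) (use less.prems assms(2) in auto)
  moreover have "poch (d / c * q powi (- int m)) (N - m) \<noteq> 0"
    by (rule poch_nz[OF g(16), of "- int m"]) (use less.prems assms(2) in auto)
  moreover have "poch (c * d * q powi int m) (N - m) \<noteq> 0"
    by (rule poch_nz[OF g(17), of "int m"]) (use less.prems assms(2) in auto)
  ultimately show ?case unfolding eh_def e by simp
qed

end

section \<open>Generic parameters\<close>

text \<open>Convergence of an infinite product includes that it is nonzero when no factor
  vanishes.\<close>

lemma etheta_eq_0_iff:
  assumes "norm p < 1"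
  shows "etheta x p = 0 \<longleftrightarrow> (\<exists>j. (1 - p ^ j * x) * (1 - p ^ (j + 1) / x) = 0)"
proof
  show "etheta x p = 0 \<Longrightarrow> \<exists>j. (1 - p ^ j * x) * (1 - p ^ (j + 1) / x) = 0"
    using prodinf_nonzero[OF convergent_prod_etheta[OF assms, of x]] unfolding etheta_def by blast
next
  assume "\<exists>j. (1 - p ^ j * x) * (1 - p ^ (j + 1) / x) = 0"
  then obtain j where j: "(1 - p ^ j * x) * (1 - p ^ (j + 1) / x) = 0" by blast
  have "eventually (\<lambda>n. (\<Prod>i<n. (1 - p ^ i * x) * (1 - p ^ (i + 1) / x)) = 0) sequentially"
    using eventually_gt_at_top[of j]
  proof eventually_elim
    case (elim n)
    then show ?case by (intro prod_zero) (use j in auto)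
  qed
  then have "(\<lambda>n. \<Prod>i<n. (1 - p ^ i * x) * (1 - p ^ (i + 1) / x)) \<longlonglongrightarrow> 0"
    by (rule tendsto_eventually)
  then show "etheta x p = 0"
    unfolding etheta_def
    using LIMSEQ_unique convergent_prod_LIMSEQ_lessThan[OF convergent_prod_etheta[OF assms, of x]] by blast
qed

lemma countable_etheta_zeros:
  assumes "norm p < 1"
  shows "countable {x. etheta x p = 0}"
proof (rule countable_subset)
  show "{x. etheta x p = 0} \<subseteq> {0} \<union> (range (\<lambda>j. 1 / p ^ j) \<union> range (\<lambda>j. p ^ (j + 1)))"
  proof
    fix x assume "x \<in> {x. etheta x p = 0}"
    then obtain j where "1 - p ^ j * x = 0 \<or> 1 - p ^ (j + 1) / x = 0"
      using etheta_eq_0_iff[OF assms, of x] by auto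
    moreover have "x = 1 / p ^ j" if "1 - p ^ j * x = 0"
    proof -
      have "p ^ j \<noteq> 0" using that by (metis diff_zero mult_zero_left zero_neq_one)
      then show ?thesis using that by (simp add: field_simps)
    qed
    ultimately consider "x = 0" | "x = 1 / p ^ j" | "x = p ^ (j + 1)"
      by (cases "x = 0") auto
    then show "x \<in> {0} \<union> (range (\<lambda>j. 1 / p ^ j) \<union> range (\<lambda>j. p ^ (j + 1)))"
      by cases auto
  qed
qed auto

text \<open>Continuity of theta is avoided: near a point y other than 0 only finitely many factors
  of the product can vanish, and these are continuous. The point 0 is excluded because for nonzero p
  the zeros p^j accumulate there.\<close>

lemma open_etheta_nonzeros:
  assumes "norm p < 1"
  shows "open {x. x \<noteq> 0 \<and> etheta x p \<noteq> 0}"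
proof (subst open_subopen, intro ballI)
  fix y assume y: "y \<in> {x. x \<noteq> 0 \<and> etheta x p \<noteq> 0}"
  define f where "f = (\<lambda>j x. (1 - p ^ j * x) * (1 - p ^ (j + 1) / x))"
  \<comment> \<open>On the ball of this radius about y one has r < |x| < 3r, which bounds x and 1/x
    together. Hence from some index \<open>J\<close> on no factor vanishes there.\<close>
  define r where "r = norm y / 2"
  have r: "r > 0" using y by (simp add: r_def)
  have "(\<lambda>j. norm p ^ j * (3 * r)) \<longlonglongrightarrow> 0 * (3 * r)" "(\<lambda>j. norm p ^ j * (1 / r)) \<longlonglongrightarrow> 0 * (1 / r)"
    by (intro tendsto_intros LIMSEQ_power_zero; use assms in simp)+
  then have "eventually (\<lambda>j. norm p ^ j * (3 * r) < 1) sequentially" "eventually (\<lambda>j. norm p ^ j * (1 / r) < 1) sequentially"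
    by (auto dest!: order_tendstoD(2)[where a = 1])
  then have "eventually (\<lambda>j. norm p ^ j * (3 * r) < 1 \<and> norm p ^ j * (1 / r) < 1) sequentially"
    by (rule eventually_conj)
  then obtain J where J: "\<And>j. j \<ge> J \<Longrightarrow> norm p ^ j * (3 * r) < 1" "\<And>j. j \<ge> J \<Longrightarrow> norm p ^ j * (1 / r) < 1"
    by (auto simp: eventually_sequentially)
  define T where "T = ball y r \<inter> (\<Inter>j<J. - {0} \<inter> f j -` (- {0}))"
  have "open (- {0} \<inter> f j -` (- {0}))" for j
    unfolding f_def by (intro continuous_open_preimage continuous_intros) auto
  then have "open T" unfolding T_def by (intro open_Int open_INT) auto
  moreover have "y \<in> T" using y r etheta_eq_0_iff[OF assms, of y] by (auto simp: T_def f_def)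
  moreover have "T \<subseteq> {x. x \<noteq> 0 \<and> etheta x p \<noteq> 0}"
  proof
    fix x assume x: "x \<in> T"
    then have "norm (y - x) < r" by (simp add: T_def dist_norm)
    then have n1: "r < norm x" "norm x < 3 * r"
      using norm_triangle_ineq2[of y x] norm_triangle_ineq2[of x y] by (auto simp: r_def norm_minus_commute)
    have x0: "x \<noteq> 0" using n1 r by auto
    have "f j x \<noteq> 0" for j
    proof (cases "j < J")
      case True
      then have "f j x \<in> - {0}" using x unfolding T_def by blast
      then show ?thesis by simp
    next
      case False
      have "norm (p ^ j * x) < 1"
        using mult_left_mono[of "norm x" "3 * r" "norm p ^ j"] n1 J(1)[of j] False by (simp add: norm_mult norm_power)
      moreover have "norm (p ^ (j + 1) / x) < 1"
      proof -
        have "norm (p ^ (j + 1) / x) = norm p ^ (j + 1) * (1 / norm x)" by (simp add: norm_divide norm_mult norm_power)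
        also have "\<dots> \<le> norm p ^ (j + 1) * (1 / r)"
          using n1 r by (intro mult_left_mono frac_le) auto
        also have "\<dots> < 1" using J(2)[of "j + 1"] False by simp
        finally show ?thesis .
      qed
      ultimately have "p ^ j * x \<noteq> 1" "p ^ (j + 1) / x \<noteq> 1" by auto
      then show ?thesis unfolding f_def by simp
    qed
    then show "x \<in> {x. x \<noteq> 0 \<and> etheta x p \<noteq> 0}"
      using x0 etheta_eq_0_iff[OF assms, of x] by (auto simp: f_def)
  qed
  ultimately show "\<exists>T. open T \<and> y \<in> T \<and> T \<subseteq> {x. x \<noteq> 0 \<and> etheta x p \<noteq> 0}" by blast
qed

lemma open_minus_countable_complex:
  fixes S A :: "complex set"
  assumes "countable A" "open S" "y \<in> S"
  shows "\<exists>x\<in>S. x \<notin> A"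
proof -
  obtain r where r: "r > 0" "ball y r \<subseteq> S" using assms(2,3) by (rule openE)
  have "\<not> S \<subseteq> A"
  proof
    assume "S \<subseteq> A"
    then have "countable (ball y r)" by (rule countable_subset[OF order.trans[OF r(2)] assms(1)])
    then show False using uncountable_ball[OF r(1), of y] by simp
  qed
  then show ?thesis by blast
qed

section \<open>Countability of the exceptional parameter values\<close>

context elliptic_base
begin

text \<open>The values y incompatible with an already chosen parameter x. They form a countable set,
  so the parameters can be picked one after another.\<close>

definition bad_partners :: "nat \<Rightarrow> complex \<Rightarrow> complex set" where
  "bad_partners M x = {y. y = 0 \<or> \<not> nz M (x / y) \<or> \<not> nz M (y / x) \<or> \<not> nz M (x * y)}"

lemma not_bad_partnersD:
  assumes "y \<notin> bad_partners M x"
  shows "y \<noteq> 0" "nz M (x / y)" "nz M (y / x)" "nz M (x * y)" "nz M (y * x)"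
  using assms by (simp_all add: bad_partners_def mult.commute)

lemma countable_bad_partners:
  assumes "x \<noteq> 0"
  shows "countable (bad_partners M x)"
proof -
  define Z where "Z = {z. \<theta> z = 0}"
  have Z: "countable Z" unfolding Z_def by (rule countable_etheta_zeros[OF norm_p])
  have nz: "\<exists>i. w * q powi i \<in> Z" if "\<not> nz M w" for w using that by (auto simp: nz_def Z_def)
  \<comment> \<open>Each way of failing determines y from a zero z of theta: y is x q^i / z, z x /
    q^i or z / (x q^i).\<close>
  define F where "F = (\<lambda>i. (\<lambda>z. x * q powi i / z) ` Z \<union> (\<lambda>z. z * x / q powi i) ` Z \<union> (\<lambda>z. z / (x * q powi i)) ` Z)"
  have "bad_partners M x \<subseteq> {0} \<union> (\<Union>i. F i)"
  proof
    fix y assume y: "y \<in> bad_partners M x"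
    show "y \<in> {0} \<union> (\<Union>i. F i)"
    proof (cases "y = 0")
      case False
      from y False obtain i where "x / y * q powi i \<in> Z \<or> y / x * q powi i \<in> Z \<or> x * y * q powi i \<in> Z"
        using nz unfolding bad_partners_def mem_Collect_eq by blast
      then have "y \<in> F i"
      proof (elim disjE)
        assume "x / y * q powi i \<in> Z"
        moreover have "y = x * q powi i / (x / y * q powi i)" using False assms q_nz by simp
        ultimately show ?thesis unfolding F_def by (metis UnI1 image_eqI)
      next
        assume "y / x * q powi i \<in> Z"
        moreover have "y = y / x * q powi i * x / q powi i" using assms q_nz by simp
        ultimately show ?thesis unfolding F_def by (metis UnI1 UnI2 image_eqI)
      next
        assume "x * y * q powi i \<in> Z"
        moreover have "y = x * y * q powi i / (x * q powi i)" using assms q_nz by simp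
        ultimately show ?thesis unfolding F_def by (metis UnI2 image_eqI)
      qed
      then show ?thesis by blast
    qed simp
  qed
  moreover have "countable ({0} \<union> (\<Union>i. F i))"
    unfolding F_def using Z by (intro countable_Un countable_UN countable_image) auto
  ultimately show ?thesis by (rule countable_subset)
qed

lemma countable_square_not_nz: "countable {y. \<not> nz M (y * y)}"
proof -
  define Z where "Z = {z. \<theta> z = 0}"
  have Z: "countable Z" unfolding Z_def by (rule countable_etheta_zeros[OF norm_p])
  have "{y. \<not> nz M (y * y)} \<subseteq> (\<Union>i. \<Union>z\<in>Z. {y. y ^ 2 = z / q powi i})"
  proof
    fix y assume "y \<in> {y. \<not> nz M (y * y)}"
    then obtain i where "y * y * q powi i \<in> Z" by (auto simp: nz_def Z_def)
    moreover have "y ^ 2 = y * y * q powi i / q powi i" using q_nz by (simp add: power2_eq_square)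
    ultimately show "y \<in> (\<Union>i. \<Union>z\<in>Z. {y. y ^ 2 = z / q powi i})"
      by (intro UN_I[of i] UN_I[of "y * y * q powi i"]) simp_all
  qed
  moreover have "countable (\<Union>i::int. \<Union>z\<in>Z. {y. y ^ 2 = z / q powi i})"
    by (intro countable_UN[OF countableI_type] countable_UN[OF Z] countable_finite finite_nth_roots) simp
  ultimately show ?thesis by (rule countable_subset)
qed

end

lemma countable_power_etheta_zeros:
  assumes "norm p < 1" "0 < i"
  shows "countable {q. etheta (q ^ i) p = 0}"
proof -
  have "{q. etheta (q ^ i) p = 0} = (\<Union>z\<in>{z. etheta z p = 0}. {q. q ^ i = z})" by auto
  also have "countable \<dots>"
    by (intro countable_UN[OF countable_etheta_zeros[OF assms(1)]] countable_finite finite_nth_roots assms(2))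
  finally show ?thesis .
qed

section \<open>Density and openness of the generic parameters\<close>

definition generic_set :: "complex \<Rightarrow> nat \<Rightarrow> (complex \<times> complex \<times> complex \<times> complex \<times> complex) set" where
  "generic_set p M = {(a, b, c, d, q). q \<noteq> 0 \<and> elliptic_base.generic4 p q M a b c d}"

text \<open>Every nonempty open set contains a box, in which each coordinate can avoid a countable
  set because complex balls are uncountable.\<close>

lemma closure_generic_set:
  assumes "norm p < 1"
  shows "closure (generic_set p M) = UNIV"
proof -
  have "\<exists>v\<in>W. v \<in> generic_set p M" if W: "open W" "v \<in> W" for v W
  proof -
    obtain a0 b0 c0 d0 q0 where v: "v = (a0, b0, c0, d0, q0)" by (cases v) auto
    obtain Sa T1 where 1: "open Sa" "open T1" "a0 \<in> Sa" "(b0, c0, d0, q0) \<in> T1" "Sa \<times> T1 \<subseteq> W"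
      using open_prod_elim[OF W] unfolding v by (metis mem_Sigma_iff)
    obtain Sb T2 where 2: "open Sb" "open T2" "b0 \<in> Sb" "(c0, d0, q0) \<in> T2" "Sb \<times> T2 \<subseteq> T1"
      using open_prod_elim[OF 1(2,4)] by (metis mem_Sigma_iff)
    obtain Sc T3 where 3: "open Sc" "open T3" "c0 \<in> Sc" "(d0, q0) \<in> T3" "Sc \<times> T3 \<subseteq> T2"
      using open_prod_elim[OF 2(2,4)] by (metis mem_Sigma_iff)
    obtain Sd Sq where 4: "open Sd" "open Sq" "d0 \<in> Sd" "q0 \<in> Sq" "Sd \<times> Sq \<subseteq> T3"
      using open_prod_elim[OF 3(2,4)] by (metis mem_Sigma_iff)
    have qc: "countable ({0} \<union> (\<Union>i\<in>{1..M}. {q. etheta (q ^ i) p = 0}))"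
      using countable_power_etheta_zeros[OF assms] by (intro countable_Un countable_UN) auto
    \<comment> \<open>The choice of q comes first, since the exceptional sets of the other
      parameters depend on it. Then c is matched to b, and d and a are matched to both b and
      c.\<close>
    obtain q where q: "q \<in> Sq" "q \<notin> {0} \<union> (\<Union>i\<in>{1..M}. {q. etheta (q ^ i) p = 0})"
      using open_minus_countable_complex[OF qc 4(2,4)] by blast
    then interpret elliptic_base p q using assms by unfold_locales auto
    obtain b where b: "b \<in> Sb" "b \<notin> {0}"
      using open_minus_countable_complex[of "{0}", OF _ 2(1,3)] by auto
    have cc: "countable (bad_partners M b \<union> {y. \<not> nz M (y * y)})"
      using countable_bad_partners countable_square_not_nz b by auto
    obtain c where c: "c \<in> Sc" "c \<notin> bad_partners M b \<union> {y. \<not> nz M (y * y)}"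
      using open_minus_countable_complex[OF cc 3(1,3)] by blast
    then have c0: "c \<noteq> 0" by (auto simp: bad_partners_def)
    have cnt: "countable (bad_partners M b \<union> bad_partners M c)"
      using countable_bad_partners b c0 by auto
    obtain d where d: "d \<in> Sd" "d \<notin> bad_partners M b \<union> bad_partners M c"
      using open_minus_countable_complex[OF cnt 4(1,3)] by blast
    obtain a where a: "a \<in> Sa" "a \<notin> bad_partners M b \<union> bad_partners M c"
      using open_minus_countable_complex[OF cnt 1(1,3)] by blast
    have bad: "a \<notin> bad_partners M b" "a \<notin> bad_partners M c" "c \<notin> bad_partners M b"
      "d \<notin> bad_partners M b" "d \<notin> bad_partners M c" using a c d by blast+
    have "generic4 M a b c d"
      unfolding generic4_def
      using bad[THEN not_bad_partnersD(1)] bad[THEN not_bad_partnersD(2)] bad[THEN not_bad_partnersD(3)]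
        bad[THEN not_bad_partnersD(4)] bad[THEN not_bad_partnersD(5)] b(2) c(2) q(2) by simp
    moreover have "(a, b, c, d, q) \<in> W"
    proof -
      have "(d, q) \<in> T3" using d(1) q(1) 4(5) by blast
      then have "(c, d, q) \<in> T2" using c(1) 3(5) by blast
      then have "(b, c, d, q) \<in> T1" using b(1) 2(5) by blast
      then show ?thesis using a(1) 1(5) by blast
    qed
    ultimately show ?thesis
      using q_nz by (intro bexI[of _ "(a, b, c, d, q)"]) (auto simp: generic_set_def)
  qed
  note dense = this
  show ?thesis
  proof (rule ccontr)
    assume "closure (generic_set p M) \<noteq> UNIV"
    then obtain v where "v \<in> - closure (generic_set p M)" by blast
    then obtain w where "w \<in> - closure (generic_set p M)" "w \<in> generic_set p M"
      using dense[of "- closure (generic_set p M)"] by blast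
    then show False using closure_subset by blast
  qed
qed

text \<open>The set is a finite intersection of preimages of the open set \<open>Z\<close>. Each is
  cut with \<open>U\<close>, where quotients and integer powers are continuous.\<close>

lemma open_generic_set:
  assumes "norm p < 1"
  shows "open (generic_set p M)"
proof -
  let ?a = "\<lambda>v::complex \<times> complex \<times> complex \<times> complex \<times> complex. fst v"
  let ?b = "\<lambda>v::complex \<times> complex \<times> complex \<times> complex \<times> complex. fst (snd v)"
  let ?c = "\<lambda>v::complex \<times> complex \<times> complex \<times> complex \<times> complex. fst (snd (snd v))"
  let ?d = "\<lambda>v::complex \<times> complex \<times> complex \<times> complex \<times> complex. fst (snd (snd (snd v)))"
  let ?q = "\<lambda>v::complex \<times> complex \<times> complex \<times> complex \<times> complex. snd (snd (snd (snd v)))"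
  define U where "U = {v. ?a v \<noteq> 0 \<and> ?b v \<noteq> 0 \<and> ?c v \<noteq> 0 \<and> ?d v \<noteq> 0 \<and> ?q v \<noteq> 0}"
  define Z where "Z = {x. x \<noteq> 0 \<and> etheta x p \<noteq> 0}"
  have U: "open U" unfolding U_def by (intro open_Collect_conj open_Collect_neq continuous_intros)
  have Z: "open Z" unfolding Z_def by (rule open_etheta_nonzeros[OF assms])
  define E where "E = (\<lambda>f. \<Inter>i\<in>{- int M..int M}. U \<inter> (\<lambda>v. f v * ?q v powi i) -` Z)"
  have E: "open (E f)" if "continuous_on U f" for f
    unfolding E_def
    by (intro open_INT finite_atLeastAtMost_int ballI continuous_open_preimage continuous_intros that U Z)
       (auto simp: U_def)
  define Q where "Q = (\<Inter>i\<in>{1..M}. U \<inter> (\<lambda>v. ?q v ^ i) -` Z)"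
  have Q: "open Q"
    unfolding Q_def by (intro open_INT finite_atLeastAtMost ballI continuous_open_preimage continuous_intros U Z)
  have "generic_set p M = U \<inter> Q \<inter> E (\<lambda>v. ?a v / ?b v) \<inter> E (\<lambda>v. ?a v * ?b v) \<inter> E (\<lambda>v. ?a v / ?c v)
     \<inter> E (\<lambda>v. ?a v * ?c v) \<inter> E (\<lambda>v. ?b v / ?c v) \<inter> E (\<lambda>v. ?c v / ?b v) \<inter> E (\<lambda>v. ?b v * ?c v)
     \<inter> E (\<lambda>v. ?b v / ?d v) \<inter> E (\<lambda>v. ?b v * ?d v) \<inter> E (\<lambda>v. ?c v / ?d v) \<inter> E (\<lambda>v. ?d v / ?c v)
     \<inter> E (\<lambda>v. ?c v * ?d v) \<inter> E (\<lambda>v. ?c v * ?c v)"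
  proof (rule set_eqI)
    fix v :: "complex \<times> complex \<times> complex \<times> complex \<times> complex"
    obtain a b c d q where v: "v = (a, b, c, d, q)" by (cases v) auto
    show "v \<in> generic_set p M \<longleftrightarrow> v \<in> U \<inter> Q \<inter> E (\<lambda>v. ?a v / ?b v) \<inter> E (\<lambda>v. ?a v * ?b v) \<inter> E (\<lambda>v. ?a v / ?c v)
     \<inter> E (\<lambda>v. ?a v * ?c v) \<inter> E (\<lambda>v. ?b v / ?c v) \<inter> E (\<lambda>v. ?c v / ?b v) \<inter> E (\<lambda>v. ?b v * ?c v)
     \<inter> E (\<lambda>v. ?b v / ?d v) \<inter> E (\<lambda>v. ?b v * ?d v) \<inter> E (\<lambda>v. ?c v / ?d v) \<inter> E (\<lambda>v. ?d v / ?c v)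
     \<inter> E (\<lambda>v. ?c v * ?d v) \<inter> E (\<lambda>v. ?c v * ?c v)"
    proof (cases "v \<in> U")
      case False
      have "v \<notin> generic_set p M"
      proof
        assume "v \<in> generic_set p M"
        then have q: "q \<noteq> 0" and g: "elliptic_base.generic4 p q M a b c d"
          by (simp_all add: generic_set_def v)
        interpret elliptic_base p q using assms q by unfold_locales
        show False using generic4D(1-4)[OF g] q False by (simp add: U_def v)
      qed
      then show ?thesis using False by (simp only: Int_iff simp_thms)
    next
      case True
      then interpret elliptic_base p q using assms by unfold_locales (auto simp: U_def v)
      have nz: "v \<in> E f \<longleftrightarrow> nz M (f v)" if "f v \<noteq> 0" for f
      proof -
        have "v \<in> E f \<longleftrightarrow> (\<forall>i\<in>{- int M..int M}. \<theta> (f v * q powi i) \<noteq> 0)"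
          using True that q_nz unfolding E_def by (simp add: Z_def v)
        also have "\<dots> \<longleftrightarrow> nz M (f v)" unfolding nz_def by (auto simp: abs_le_iff)
        finally show ?thesis .
      qed
      have abcd: "a \<noteq> 0" "b \<noteq> 0" "c \<noteq> 0" "d \<noteq> 0" using True by (auto simp: U_def v)
      have E_iff: "v \<in> E (\<lambda>v. ?a v / ?b v) \<longleftrightarrow> nz M (a / b)"
        "v \<in> E (\<lambda>v. ?a v * ?b v) \<longleftrightarrow> nz M (a * b)"
        "v \<in> E (\<lambda>v. ?a v / ?c v) \<longleftrightarrow> nz M (a / c)"
        "v \<in> E (\<lambda>v. ?a v * ?c v) \<longleftrightarrow> nz M (a * c)"
        "v \<in> E (\<lambda>v. ?b v / ?c v) \<longleftrightarrow> nz M (b / c)"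
        "v \<in> E (\<lambda>v. ?c v / ?b v) \<longleftrightarrow> nz M (c / b)"
        "v \<in> E (\<lambda>v. ?b v * ?c v) \<longleftrightarrow> nz M (b * c)"
        "v \<in> E (\<lambda>v. ?b v / ?d v) \<longleftrightarrow> nz M (b / d)"
        "v \<in> E (\<lambda>v. ?b v * ?d v) \<longleftrightarrow> nz M (b * d)"
        "v \<in> E (\<lambda>v. ?c v / ?d v) \<longleftrightarrow> nz M (c / d)"
        "v \<in> E (\<lambda>v. ?d v / ?c v) \<longleftrightarrow> nz M (d / c)"
        "v \<in> E (\<lambda>v. ?c v * ?d v) \<longleftrightarrow> nz M (c * d)"
        "v \<in> E (\<lambda>v. ?c v * ?c v) \<longleftrightarrow> nz M (c * c)"
        by (subst nz; use abcd in \<open>simp add: v\<close>)+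
      have Q_iff: "v \<in> Q \<longleftrightarrow> (\<forall>i\<in>{1..M}. \<theta> (q ^ i) \<noteq> 0)"
        using True q_nz unfolding Q_def by (auto simp: Z_def v)
      have "v \<in> generic_set p M \<longleftrightarrow> generic4 M a b c d"
        using q_nz by (simp add: generic_set_def v)
      then show ?thesis using True abcd unfolding Int_iff E_iff Q_iff generic4_def by blast
    qed
  qed
  moreover have "open \<dots>"
    by (intro open_Int U Q E continuous_intros; simp add: U_def)
  ultimately show ?thesis by simp
qed

theorem mainTheorem12:
  fixes N :: nat and p :: complex
  assumes "norm p < 1"
  shows "\<exists>S :: (complex \<times> complex \<times> complex \<times> complex \<times> complex) set.
           open S \<and> closure S = UNIV \<and>
           (\<forall>a b c d q. (a, b, c, d, q) \<in> S \<longrightarrow>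
              (\<forall>k\<le>N. \<forall>\<xi>. \<xi> \<noteq> 0 \<longrightarrow>
                 eh q p a k \<xi> * eh q p b (N - k) \<xi>
                 = (\<Sum>l\<le>N. Rcoef a b c d N q p k l * eh q p c l \<xi> * eh q p d (N - l) \<xi>))
            \<and> (\<forall>k\<le>N. \<forall>R' :: nat \<Rightarrow> complex.
                 (\<forall>\<xi>. \<xi> \<noteq> 0 \<longrightarrow>
                    eh q p a k \<xi> * eh q p b (N - k) \<xi>
                    = (\<Sum>l\<le>N. R' l * eh q p c l \<xi> * eh q p d (N - l) \<xi>))
                 \<longrightarrow> (\<forall>l\<le>N. R' l = Rcoef a b c d N q p k l)))"
\<comment> \<open>The window 2N + 1 is the least M with 2N < M, as \<open>connection\<close> and
  \<open>products_independent\<close> require.\<close>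
proof (intro exI[of _ "generic_set p (2 * N + 1)"] conjI allI impI)
  show "open (generic_set p (2 * N + 1))" by (rule open_generic_set[OF assms])
  show "closure (generic_set p (2 * N + 1)) = UNIV" by (rule closure_generic_set[OF assms])
next
  fix a b c d q k \<xi>
  assume S: "(a, b, c, d, q) \<in> generic_set p (2 * N + 1)" and k: "k \<le> N" and "\<xi> \<noteq> (0 :: complex)"
  then interpret elliptic_base p q using assms by unfold_locales (auto simp: generic_set_def)
  show "eh q p a k \<xi> * eh q p b (N - k) \<xi>
      = (\<Sum>l\<le>N. Rcoef a b c d N q p k l * eh q p c l \<xi> * eh q p d (N - l) \<xi>)"
    by (rule connection[of "2 * N + 1"]) (use S k \<open>\<xi> \<noteq> 0\<close> in \<open>auto simp: generic_set_def\<close>)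
next
  fix a b c d q k R' l
  assume S: "(a, b, c, d, q) \<in> generic_set p (2 * N + 1)" and k: "k \<le> N" and l: "l \<le> N"
    and R': "\<forall>\<xi>. \<xi> \<noteq> 0 \<longrightarrow> eh q p a k \<xi> * eh q p b (N - k) \<xi>
                    = (\<Sum>l\<le>N. R' l * eh q p c l \<xi> * eh q p d (N - l) \<xi>)"
  interpret elliptic_base p q using assms S by unfold_locales (auto simp: generic_set_def)
  have g: "generic4 (2 * N + 1) a b c d" using S by (auto simp: generic_set_def)
  have "R' l - Rcoef a b c d N q p k l = 0"
  proof (rule products_independent[OF g, of N "\<lambda>l. R' l - Rcoef a b c d N q p k l"])
    fix \<xi> :: complex assume "\<xi> \<noteq> 0"
    then show "(\<Sum>l\<le>N. (R' l - Rcoef a b c d N q p k l) * eh q p c l \<xi> * eh q p d (N - l) \<xi>) = 0"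
      using R' connection[OF g _ k, of \<xi>] by (simp add: left_diff_distrib sum_subtractf)
  qed (use l in auto)
  then show "R' l = Rcoef a b c d N q p k l" by simp
qed

end
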